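(* Let $A\,|\,B\,|\,C$ be a tower of rings, let $V=A^C$ be the centralizer of $C$ in $A$, and let $P=(A\otimes_BA)^C$. Then $A\,|\,B\,|\,C$ is right depth three if and only if the left $V$-module ${}_VP$ is finitely generated projective and $A\otimes_VP\cong A\otimes_BA$ as natural $A$-$C$-bimodules.
   Context: Rings are unital. A tower $A\,|\,B\,|\,C$ is a pair of unital ring homomorphisms $C\to B\to A$, with induced bimodule structures. The tower is right depth three if, as $A$-$C$-bimodules, $A\otimes_BA$ is isomorphic to a direct summand of $A^N$ for some positive integer $N$. For an $A$-$A$-bimodule $M$, $M^C=\{m\in M: cm=mc\text{ for all }c\in C\}$; in particular $V=A^C$ is a subring of $A$. $P$ is a left $V$-module via $v\cdot(p^1\otimes_Bp^2)=vp^1\otimes_Bp^2$ (summation suppressed). The natural $A$-$C$-bimodule structure on $A\otimes_VP$ comes from the factor $A$: $a'(a\otimes p)c=a'ac\otimes p$, which is well defined since $C$ and $V$ commute in $A$. *)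

theory Defs
  imports "HOL-Algebra.Algebra"
begin

text \<open>
  HOL-Algebra modules are over commutative rings, and there are no bimodules or tensor products
  over noncommutative rings. The records below carry the data only. As with the library's
  \<^type>\<open>module\<close> record, the inherited fields \<^const>\<open>monoid.mult\<close> and \<^const>\<open>monoid.one\<close> play no role for modules.
  An \<open>('r, 'm, 's) bimodule\<close> is used as an \<open>R\<close>-\<open>S\<close>-bimodule, where \<open>R\<close>, \<open>S\<close> are rings on \<open>'r\<close>, \<open>'s\<close>.
\<close>

record ('r, 'm, 's) bimodule = "('r, 'm) module" +
  rsmult :: "'m \<Rightarrow> 's \<Rightarrow> 'm"

text \<open>For ring homomorphisms \<open>f : R \<rightarrow> A\<close> and \<open>g : S \<rightarrow> A\<close>, the ring \<open>A\<close> as an \<open>R\<close>-\<open>S\<close>-bimodule.\<close>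

definition ring_bimodule ::
    "('a, 'x) ring_scheme \<Rightarrow> ('r \<Rightarrow> 'a) \<Rightarrow> ('s \<Rightarrow> 'a) \<Rightarrow> ('r, 'a, 's) bimodule" where
  "ring_bimodule A f g =
    \<lparr>carrier = carrier A, monoid.mult = monoid.mult A, monoid.one = monoid.one A,
     ring.zero = ring.zero A, ring.add = ring.add A,
     smult = (\<lambda>r a. f r \<otimes>\<^bsub>A\<^esub> a), rsmult = (\<lambda>a s. a \<otimes>\<^bsub>A\<^esub> g s)\<rparr>"

definition restrict_right ::
    "('t \<Rightarrow> 's) \<Rightarrow> ('r, 'm, 's) bimodule \<Rightarrow> ('r, 'm, 't) bimodule" where
  "restrict_right g M =
    module.extend (module.truncate M) (bimodule.fields (\<lambda>m t. rsmult M m (g t)))"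

text \<open>For an \<open>A\<close>-\<open>A\<close>-bimodule \<open>M\<close> and \<open>f : C \<rightarrow> A\<close>: the underlying set of \<open>M\<^sup>C\<close>.\<close>

definition invariants ::
    "('c, 'x) ring_scheme \<Rightarrow> ('c \<Rightarrow> 'a) \<Rightarrow> ('a, 'm, 'a) bimodule \<Rightarrow> 'm set" where
  "invariants C f M =
    {m \<in> carrier M. \<forall>c\<in>carrier C. f c \<odot>\<^bsub>M\<^esub> m = rsmult M m (f c)}"


section \<open>Isomorphisms, direct summands, finitely generated projective modules\<close>

definition module_isomorphic ::
    "('r, 'x) ring_scheme \<Rightarrow> ('r, 'm, 'y) module_scheme \<Rightarrow> ('r, 'n, 'z) module_scheme \<Rightarrow> bool" where
  "module_isomorphic R M N \<longleftrightarrow>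
    (\<exists>h\<in>iso (add_monoid M) (add_monoid N).
       \<forall>r\<in>carrier R. \<forall>m\<in>carrier M. h (r \<odot>\<^bsub>M\<^esub> m) = r \<odot>\<^bsub>N\<^esub> h m)"

definition bimodule_isomorphic ::
    "('r, 'x) ring_scheme \<Rightarrow> ('s, 'y) ring_scheme \<Rightarrow>
     ('r, 'm, 's) bimodule \<Rightarrow> ('r, 'n, 's) bimodule \<Rightarrow> bool" where
  "bimodule_isomorphic R S M N \<longleftrightarrow>
    (\<exists>h\<in>iso (add_monoid M) (add_monoid N).
       (\<forall>r\<in>carrier R. \<forall>m\<in>carrier M. h (r \<odot>\<^bsub>M\<^esub> m) = r \<odot>\<^bsub>N\<^esub> h m) \<and>
       (\<forall>s\<in>carrier S. \<forall>m\<in>carrier M. h (rsmult M m s) = rsmult N (h m) s))"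

definition subbimodule ::
    "'m set \<Rightarrow> ('r, 'x) ring_scheme \<Rightarrow> ('s, 'y) ring_scheme \<Rightarrow> ('r, 'm, 's) bimodule \<Rightarrow> bool" where
  "subbimodule K R S M \<longleftrightarrow>
    submodule K R M \<and> (\<forall>s\<in>carrier S. \<forall>m\<in>K. rsmult M m s \<in> K)"

text \<open>\<open>M\<close> is isomorphic to a direct summand \<open>K\<close> of \<open>W = K \<oplus> L\<close> (internal direct sum).\<close>

definition iso_direct_summand ::
    "('r, 'x) ring_scheme \<Rightarrow> ('r, 'm, 'y) module_scheme \<Rightarrow> ('r, 'w, 'z) module_scheme \<Rightarrow> bool" where
  "iso_direct_summand R M W \<longleftrightarrow>
    (\<exists>K L. submodule K R W \<and> submodule L R W \<and>
       K <+>\<^bsub>W\<^esub> L = carrier W \<and> K \<inter> L = {\<zero>\<^bsub>W\<^esub>} \<and>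
       module_isomorphic R M (W\<lparr>carrier := K\<rparr>))"

definition bimodule_iso_direct_summand ::
    "('r, 'x) ring_scheme \<Rightarrow> ('s, 'y) ring_scheme \<Rightarrow>
     ('r, 'm, 's) bimodule \<Rightarrow> ('r, 'w, 's) bimodule \<Rightarrow> bool" where
  "bimodule_iso_direct_summand R S M W \<longleftrightarrow>
    (\<exists>K L. subbimodule K R S W \<and> subbimodule L R S W \<and>
       K <+>\<^bsub>W\<^esub> L = carrier W \<and> K \<inter> L = {\<zero>\<^bsub>W\<^esub>} \<and>
       bimodule_isomorphic R S M (W\<lparr>carrier := K\<rparr>))"

definition bimodule_power :: "nat \<Rightarrow> ('r, 'm, 's) bimodule \<Rightarrow> ('r, nat \<Rightarrow> 'm, 's) bimodule" where
  "bimodule_power n M =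
    \<lparr>carrier = {..<n} \<rightarrow>\<^sub>E carrier M, monoid.mult = undefined, monoid.one = undefined,
     ring.zero = (\<lambda>i\<in>{..<n}. \<zero>\<^bsub>M\<^esub>),
     ring.add = (\<lambda>u v. \<lambda>i\<in>{..<n}. u i \<oplus>\<^bsub>M\<^esub> v i),
     smult = (\<lambda>r u. \<lambda>i\<in>{..<n}. r \<odot>\<^bsub>M\<^esub> u i),
     rsmult = (\<lambda>u s. \<lambda>i\<in>{..<n}. rsmult M (u i) s)\<rparr>"

text \<open>The free left \<open>R\<close>-module on the set \<open>I\<close>: finitely supported families.\<close>

definition free_module :: "('r, 'x) ring_scheme \<Rightarrow> 'i set \<Rightarrow> ('r, 'i \<Rightarrow> 'r) module" where
  "free_module R I =
    \<lparr>carrier = {u \<in> I \<rightarrow>\<^sub>E carrier R. finite {i \<in> I. u i \<noteq> \<zero>\<^bsub>R\<^esub>}},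
     monoid.mult = undefined, monoid.one = undefined,
     ring.zero = (\<lambda>i\<in>I. \<zero>\<^bsub>R\<^esub>),
     ring.add = (\<lambda>u v. \<lambda>i\<in>I. u i \<oplus>\<^bsub>R\<^esub> v i),
     smult = (\<lambda>r u. \<lambda>i\<in>I. r \<otimes>\<^bsub>R\<^esub> u i)\<rparr>"

definition finitely_generated ::
    "('r, 'x) ring_scheme \<Rightarrow> ('r, 'm, 'y) module_scheme \<Rightarrow> bool" where
  "finitely_generated R M \<longleftrightarrow>
    (\<exists>S \<subseteq> carrier M. finite S \<and>
       carrier M = {\<Oplus>\<^bsub>M\<^esub>s\<in>S. a s \<odot>\<^bsub>M\<^esub> s | a. a \<in> S \<rightarrow> carrier R})"

text \<open>
  Projective: a direct summand of a free module. Basis sets in the element type of \<open>M\<close> suffice: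
  every \<open>M\<close> is a quotient of the free module on its own carrier, and the quotient map splits
  if \<open>M\<close> is projective.
\<close>

definition projective_module ::
    "('r, 'x) ring_scheme \<Rightarrow> ('r, 'm, 'y) module_scheme \<Rightarrow> bool" where
  "projective_module R M \<longleftrightarrow> (\<exists>I :: 'm set. iso_direct_summand R M (free_module R I))"


section \<open>Tensor products\<close>

text \<open>
  For a right \<open>R\<close>-module \<open>M\<close> (the right action of a bimodule) and a left \<open>R\<close>-module \<open>N\<close>, the group
  \<open>M \<otimes>\<^sub>R N\<close> is the free abelian group on \<open>M \<times> N\<close> modulo the subgroup generated by the usual relators.
  The pure tensor of \<open>m\<close> and \<open>n\<close> is the coset of \<open>frag_of (m, n)\<close>.
\<close>

definition tensor_free ::
    "('q, 'm, 'r) bimodule \<Rightarrow> ('r, 'n, 'z) module_scheme \<Rightarrow> ('m \<times> 'n \<Rightarrow>\<^sub>0 int) monoid" where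
  "tensor_free M N = free_Abelian_group (carrier M \<times> carrier N)"

definition tensor_relators ::
    "('r, 'x) ring_scheme \<Rightarrow> ('q, 'm, 'r) bimodule \<Rightarrow> ('r, 'n, 'z) module_scheme \<Rightarrow>
     ('m \<times> 'n \<Rightarrow>\<^sub>0 int) set" where
  "tensor_relators R M N =
     {frag_of (m \<oplus>\<^bsub>M\<^esub> m', n) - frag_of (m, n) - frag_of (m', n) | m m' n.
        m \<in> carrier M \<and> m' \<in> carrier M \<and> n \<in> carrier N} \<union>
     {frag_of (m, n \<oplus>\<^bsub>N\<^esub> n') - frag_of (m, n) - frag_of (m, n') | m n n'.
        m \<in> carrier M \<and> n \<in> carrier N \<and> n' \<in> carrier N} \<union>
     {frag_of (rsmult M m r, n) - frag_of (m, r \<odot>\<^bsub>N\<^esub> n) | m r n.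
        m \<in> carrier M \<and> r \<in> carrier R \<and> n \<in> carrier N}"

definition tensor_kernel ::
    "('r, 'x) ring_scheme \<Rightarrow> ('q, 'm, 'r) bimodule \<Rightarrow> ('r, 'n, 'z) module_scheme \<Rightarrow>
     ('m \<times> 'n \<Rightarrow>\<^sub>0 int) set" where
  "tensor_kernel R M N = generate (tensor_free M N) (tensor_relators R M N)"

definition tensor_group ::
    "('r, 'x) ring_scheme \<Rightarrow> ('q, 'm, 'r) bimodule \<Rightarrow> ('r, 'n, 'z) module_scheme \<Rightarrow>
     ('m \<times> 'n \<Rightarrow>\<^sub>0 int) set monoid" where
  "tensor_group R M N = tensor_free M N Mod tensor_kernel R M N"

text \<open>
  The endomorphism \<open>m \<otimes> n \<mapsto> f m \<otimes> g n\<close> of \<open>M \<otimes>\<^sub>R N\<close>, for \<open>R\<close>-linear endomorphisms \<open>f\<close> of \<open>M\<close>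
  and \<open>g\<close> of \<open>N\<close>. All cosets in the union then coincide.
\<close>

definition tensor_map ::
    "('r, 'x) ring_scheme \<Rightarrow> ('q, 'm, 'r) bimodule \<Rightarrow> ('r, 'n, 'z) module_scheme \<Rightarrow>
     ('m \<Rightarrow> 'm) \<Rightarrow> ('n \<Rightarrow> 'n) \<Rightarrow> ('m \<times> 'n \<Rightarrow>\<^sub>0 int) set \<Rightarrow> ('m \<times> 'n \<Rightarrow>\<^sub>0 int) set" where
  "tensor_map R M N f g T =
    (\<Union>x\<in>T. tensor_kernel R M N #>\<^bsub>tensor_free M N\<^esub>
             frag_extend (\<lambda>(m, n). frag_of (f m, g n)) x)"

text \<open>
  \<open>M \<otimes>\<^sub>R N\<close> with the left action coming from that of \<open>M\<close> and a right action supplied by the caller,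
  since it may come from either factor.
\<close>

definition tensor ::
    "('r, 'x) ring_scheme \<Rightarrow> ('q, 'm, 'r) bimodule \<Rightarrow> ('r, 'n, 'z) module_scheme \<Rightarrow>
     (('m \<times> 'n \<Rightarrow>\<^sub>0 int) set \<Rightarrow> 's \<Rightarrow> ('m \<times> 'n \<Rightarrow>\<^sub>0 int) set) \<Rightarrow>
     ('q, ('m \<times> 'n \<Rightarrow>\<^sub>0 int) set, 's) bimodule" where
  "tensor R M N ract =
    \<lparr>carrier = carrier (tensor_group R M N), monoid.mult = undefined, monoid.one = undefined,
     ring.zero = \<one>\<^bsub>tensor_group R M N\<^esub>, ring.add = monoid.mult (tensor_group R M N),
     smult = (\<lambda>q. tensor_map R M N (\<lambda>m. q \<odot>\<^bsub>M\<^esub> m) (\<lambda>n. n)),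
     rsmult = ract\<rparr>"


section \<open>Towers of rings\<close>

text \<open>Throughout, \<open>\<phi> : B \<rightarrow> A\<close> and \<open>\<psi> : C \<rightarrow> B\<close>. First \<open>A \<otimes>\<^sub>B A\<close> as an \<open>A\<close>-\<open>A\<close>-bimodule.\<close>

definition tensor_AA ::
    "('a, 'x) ring_scheme \<Rightarrow> ('b, 'y) ring_scheme \<Rightarrow> ('b \<Rightarrow> 'a) \<Rightarrow>
     ('a, ('a \<times> 'a \<Rightarrow>\<^sub>0 int) set, 'a) bimodule" where
  "tensor_AA A B \<phi> =
    (let M = ring_bimodule A (\<lambda>a. a) \<phi>; N = ring_bimodule A \<phi> (\<lambda>a. a)
     in tensor B M N (\<lambda>T a. tensor_map B M N (\<lambda>m. m) (\<lambda>n. rsmult N n a) T))"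

definition right_depth_three ::
    "('a, 'x) ring_scheme \<Rightarrow> ('b, 'y) ring_scheme \<Rightarrow> ('c, 'z) ring_scheme \<Rightarrow>
     ('b \<Rightarrow> 'a) \<Rightarrow> ('c \<Rightarrow> 'b) \<Rightarrow> bool" where
  "right_depth_three A B C \<phi> \<psi> \<longleftrightarrow>
    (\<exists>N>0. bimodule_iso_direct_summand A C
       (restrict_right (\<phi> \<circ> \<psi>) (tensor_AA A B \<phi>))
       (bimodule_power N (ring_bimodule A (\<lambda>a. a) (\<phi> \<circ> \<psi>))))"

definition centralizer_ring ::
    "('a, 'x) ring_scheme \<Rightarrow> ('c, 'z) ring_scheme \<Rightarrow> ('c \<Rightarrow> 'a) \<Rightarrow> ('a, 'x) ring_scheme" where
  "centralizer_ring A C f =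
    A\<lparr>carrier := invariants C f (ring_bimodule A (\<lambda>a. a) (\<lambda>a. a))\<rparr>"

text \<open>\<open>P = (A \<otimes>\<^sub>B A)\<^sup>C\<close> with the left action of \<open>A \<otimes>\<^sub>B A\<close>, to be used for scalars in \<open>V = A\<^sup>C\<close> only.\<close>

definition tensor_AA_invariants ::
    "('a, 'x) ring_scheme \<Rightarrow> ('b, 'y) ring_scheme \<Rightarrow> ('c, 'z) ring_scheme \<Rightarrow>
     ('b \<Rightarrow> 'a) \<Rightarrow> ('c \<Rightarrow> 'b) \<Rightarrow> ('a, ('a \<times> 'a \<Rightarrow>\<^sub>0 int) set) module" where
  "tensor_AA_invariants A B C \<phi> \<psi> =
    (module.truncate (tensor_AA A B \<phi>))
      \<lparr>carrier := invariants C (\<phi> \<circ> \<psi>) (tensor_AA A B \<phi>)\<rparr>"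

text \<open>\<open>A \<otimes>\<^sub>V P\<close> for \<open>V = A\<^sup>C\<close>, \<open>f : C \<rightarrow> A\<close>; both actions come from the factor \<open>A\<close>.\<close>

definition tensor_AP ::
    "('a, 'x) ring_scheme \<Rightarrow> ('c, 'z) ring_scheme \<Rightarrow> ('c \<Rightarrow> 'a) \<Rightarrow> ('a, 'p) module \<Rightarrow>
     ('a, ('a \<times> 'p \<Rightarrow>\<^sub>0 int) set, 'c) bimodule" where
  "tensor_AP A C f P =
    (let V = centralizer_ring A C f; M = ring_bimodule A (\<lambda>a. a) (\<lambda>v. v)
     in tensor V M P (\<lambda>T c. tensor_map V M P (\<lambda>m. m \<otimes>\<^bsub>A\<^esub> f c) (\<lambda>p. p) T))"

end

theory Submission
  imports Defs
begin

text \<open>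
  Put \<open>D = A \<otimes>\<^sub>B A\<close>, so that \<open>P = D\<^sup>C\<close>. The argument works for
  an arbitrary \<open>A\<close>-\<open>C\<close>-bimodule \<open>D\<close> on which \<open>C\<close> also acts from the left through a map
  \<open>f : C \<rightarrow> A\<close> (locale \<open>scalar_bimodule\<close>).

  Everything is expressed by one kind of data. A direct summand of \<open>A\<^sup>N\<close> is a retract, that is, a pair
  \<open>\<iota> : D \<rightarrow> A\<^sup>N\<close>, \<open>\<pi> : A\<^sup>N \<rightarrow> D\<close> with \<open>\<pi> \<circ> \<iota> = id\<close>. Reading off the coordinates \<open>g\<^sub>i\<close> of \<open>\<iota>\<close> and the
  images \<open>t\<^sub>i\<close> of the unit vectors under \<open>\<pi>\<close>, this becomes a finite dual basis, \<open>x = \<Sum> g\<^sub>i(x) t\<^sub>i\<close>. The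
  \<open>C\<close>-linearity of \<open>\<pi>\<close> says precisely that \<open>t\<^sub>i \<in> P\<close>, because the unit vectors of \<open>A\<^sup>N\<close> commute with
  \<open>C\<close>; the \<open>C\<close>-linearity of \<open>\<iota>\<close> says that \<open>g\<^sub>i(x c) = g\<^sub>i(x) f(c)\<close>
  (\<open>summand_of_power_iff_dual_basis\<close>). Finitely generated projective modules are likewise those with a
  finite dual basis (\<open>finitely_generated_projective_iff_dual_basis\<close>).

  Suppose \<open>D\<close> has such a dual basis of bimodule maps. For \<open>p \<in> P\<close> one has
  \<open>f(c) g\<^sub>i(p) = g\<^sub>i(c p) = g\<^sub>i(p c) = g\<^sub>i(p) f(c)\<close>, so \<open>g\<^sub>i\<close> maps \<open>P\<close> into \<open>V\<close> and the same data are a dual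
  basis of the \<open>V\<close>-module \<open>P\<close>. Moreover \<open>a \<otimes> p \<mapsto> a p\<close> from \<open>A \<otimes>\<^sub>V P\<close> to \<open>D\<close> has the inverse
  \<open>x \<mapsto> \<Sum> g\<^sub>i(x) \<otimes> t\<^sub>i\<close>.

  Conversely, a dual basis \<open>(t\<^sub>i, h\<^sub>i)\<close> of \<open>P\<close> over \<open>V\<close> induces the dual basis of \<open>A \<otimes>\<^sub>V P\<close> with elements
  \<open>1 \<otimes> t\<^sub>i\<close> and functionals \<open>a \<otimes> p \<mapsto> a h\<^sub>i(p)\<close>. These functionals are right \<open>C\<close>-linear since \<open>h\<^sub>i(p)\<close>
  lies in \<open>V\<close> (\<open>bimodule_dual_basis_AP\<close>). It can be transported along any bimodule isomorphism
  \<open>A \<otimes>\<^sub>V P \<cong> D\<close>.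

  The identities between maps on tensor products are all checked on pure tensors, using that a
  homomorphism is determined there (\<open>tensor_hom_eqI\<close>) and that every balanced map extends
  (\<open>tensor_lift\<close>).
\<close>

section \<open>Direct summands as retracts\<close>

text \<open>
  Stated for abelian groups with an arbitrary set \<open>Q\<close> of operators, which covers left modules
  (\<open>Q\<close> is the ring) and bimodules (\<open>Q\<close> is the disjoint union of the carriers of the two
  rings). From an internal decomposition \<open>K \<oplus> L\<close> with \<open>h : M \<cong> K\<close>, the retraction is the projection to \<open>K\<close> followed by the
  inverse of \<open>h\<close>; from a retraction, \<open>K\<close> is the image of \<open>\<iota>\<close> and \<open>L\<close> the kernel of \<open>\<pi>\<close>.
\<close>
lemma direct_summand_iff_retract:
  assumes M: "comm_group M" and W: "comm_group W"
    and om: "\<And>q x. q \<in> Q \<Longrightarrow> x \<in> carrier M \<Longrightarrow> om q x \<in> carrier M"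
    and ow: "\<And>q. q \<in> Q \<Longrightarrow> ow q \<in> hom W W"
  shows
    "(\<exists>K L. subgroup K W \<and> (\<forall>q\<in>Q. \<forall>w\<in>K. ow q w \<in> K) \<and>
        subgroup L W \<and> (\<forall>q\<in>Q. \<forall>w\<in>L. ow q w \<in> L) \<and>
        K <#>\<^bsub>W\<^esub> L = carrier W \<and> K \<inter> L = {\<one>\<^bsub>W\<^esub>} \<and>
        (\<exists>h\<in>iso M (W\<lparr>carrier := K\<rparr>). \<forall>q\<in>Q. \<forall>x\<in>carrier M. h (om q x) = ow q (h x))) \<longleftrightarrow>
     (\<exists>\<iota>\<in>hom M W. \<exists>\<pi>\<in>hom W M.
        (\<forall>q\<in>Q. \<forall>x\<in>carrier M. \<iota> (om q x) = ow q (\<iota> x)) \<and>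
        (\<forall>q\<in>Q. \<forall>w\<in>carrier W. \<pi> (ow q w) = om q (\<pi> w)) \<and>
        (\<forall>x\<in>carrier M. \<pi> (\<iota> x) = x))"
    (is "?summand \<longleftrightarrow> ?retract")
proof
  interpret M: comm_group M by (rule M)
  interpret W: comm_group W by (rule W)
  show ?retract if ?summand
  proof -
    from that obtain K L h where K: "subgroup K W" and L: "subgroup L W"
      and QK: "\<forall>q\<in>Q. \<forall>w\<in>K. ow q w \<in> K"
      and QL: "\<forall>q\<in>Q. \<forall>w\<in>L. ow q w \<in> L"
      and sum: "K <#>\<^bsub>W\<^esub> L = carrier W" and int: "K \<inter> L = {\<one>\<^bsub>W\<^esub>}"
      and h: "h \<in> iso M (W\<lparr>carrier := K\<rparr>)"
      and hq: "\<forall>q\<in>Q. \<forall>x\<in>carrier M. h (om q x) = ow q (h x)"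
      by (elim exE conjE bexE) (rule that)
    have Kc: "x \<in> carrier W" if "x \<in> K" for x using that K by (rule subgroup.mem_carrier[rotated])
    have Lc: "x \<in> carrier W" if "x \<in> L" for x using that L by (rule subgroup.mem_carrier[rotated])
    have bij: "bij_betw h (carrier M) K" using h by (simp add: iso_def)
    have hK: "h x \<in> K" if "x \<in> carrier M" for x using bij that by (auto simp: bij_betw_def)
    have hm: "h (x \<otimes>\<^bsub>M\<^esub> y) = h x \<otimes>\<^bsub>W\<^esub> h y" if "x \<in> carrier M" "y \<in> carrier M" for x y
      using h that by (simp add: iso_def hom_def)
    have ex: "\<exists>!x. x \<in> carrier M \<and> (\<exists>l\<in>L. w = h x \<otimes>\<^bsub>W\<^esub> l)" if w: "w \<in> carrier W" for w
    proof (rule ex_ex1I)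
      obtain k l where "k \<in> K" "l \<in> L" "w = k \<otimes>\<^bsub>W\<^esub> l" using w sum[symmetric] unfolding set_mult_def by auto
      then show "\<exists>x. x \<in> carrier M \<and> (\<exists>l\<in>L. w = h x \<otimes>\<^bsub>W\<^esub> l)"
        using bij unfolding bij_betw_def by (metis (no_types, lifting) image_iff)
    next
      fix x y
      assume x: "x \<in> carrier M \<and> (\<exists>l\<in>L. w = h x \<otimes>\<^bsub>W\<^esub> l)"
        and y: "y \<in> carrier M \<and> (\<exists>l\<in>L. w = h y \<otimes>\<^bsub>W\<^esub> l)"
      then obtain l l' where l: "l \<in> L" "l' \<in> L" "h x \<otimes>\<^bsub>W\<^esub> l = h y \<otimes>\<^bsub>W\<^esub> l'" by auto
      have c: "h x \<in> carrier W" "h y \<in> carrier W" "l \<in> carrier W" "l' \<in> carrier W"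
        using x y l hK Kc Lc by auto
      have "inv\<^bsub>W\<^esub> h y \<otimes>\<^bsub>W\<^esub> h x = l' \<otimes>\<^bsub>W\<^esub> inv\<^bsub>W\<^esub> l"
        using l(3) c by (metis W.inv_closed W.inv_solve_left W.inv_solve_right W.m_assoc W.m_closed)
      moreover have "inv\<^bsub>W\<^esub> h y \<otimes>\<^bsub>W\<^esub> h x \<in> K"
        using x y hK K by (simp add: subgroup.m_closed subgroup.m_inv_closed)
      moreover have "l' \<otimes>\<^bsub>W\<^esub> inv\<^bsub>W\<^esub> l \<in> L"
        using l L by (simp add: subgroup.m_closed subgroup.m_inv_closed)
      ultimately have "inv\<^bsub>W\<^esub> h y \<otimes>\<^bsub>W\<^esub> h x = \<one>\<^bsub>W\<^esub>" using int by auto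
      then have "h x = h y" using c by (metis W.inv_equality W.inv_inv W.inv_closed)
      then show "x = y" using x y bij by (auto simp: bij_betw_def inj_on_def)
    qed
    \<comment> \<open>By the decomposition, \<open>w = h x + l\<close> determines \<open>x\<close>: this is the retraction.\<close>
    define \<pi> where "\<pi> w = (THE x. x \<in> carrier M \<and> (\<exists>l\<in>L. w = h x \<otimes>\<^bsub>W\<^esub> l))" for w
    have \<pi>: "\<pi> w \<in> carrier M \<and> (\<exists>l\<in>L. w = h (\<pi> w) \<otimes>\<^bsub>W\<^esub> l)" if "w \<in> carrier W" for w
      unfolding \<pi>_def by (rule theI'[OF ex[OF that]])
    have \<pi>I: "\<pi> (h x \<otimes>\<^bsub>W\<^esub> l) = x" if "x \<in> carrier M" "l \<in> L" for x l
      unfolding \<pi>_def by (rule the1_equality[OF ex]) (use that hK Kc Lc in auto)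
    have "h \<in> hom M W" using hK Kc hm by (auto simp: hom_def)
    moreover have "\<pi> \<in> hom W M"
    proof (rule homI)
      fix v w assume vw: "v \<in> carrier W" "w \<in> carrier W"
      obtain k l where kl: "k \<in> L" "l \<in> L" "v = h (\<pi> v) \<otimes>\<^bsub>W\<^esub> k" "w = h (\<pi> w) \<otimes>\<^bsub>W\<^esub> l"
        using \<pi> vw by blast
      have c: "\<pi> v \<in> carrier M" "\<pi> w \<in> carrier M" using \<pi> vw by auto
      have "v \<otimes>\<^bsub>W\<^esub> w = (h (\<pi> v) \<otimes>\<^bsub>W\<^esub> k) \<otimes>\<^bsub>W\<^esub> (h (\<pi> w) \<otimes>\<^bsub>W\<^esub> l)" using kl by simp
      also have "\<dots> = h (\<pi> v \<otimes>\<^bsub>M\<^esub> \<pi> w) \<otimes>\<^bsub>W\<^esub> (k \<otimes>\<^bsub>W\<^esub> l)"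
        using c kl(1,2) by (simp add: hm W.m_ac hK Kc Lc)
      finally show "\<pi> (v \<otimes>\<^bsub>W\<^esub> w) = \<pi> v \<otimes>\<^bsub>M\<^esub> \<pi> w"
        using c kl(1,2) L by (simp add: \<pi>I subgroup.m_closed)
    qed (use \<pi> in auto)
    moreover have "\<pi> (ow q w) = om q (\<pi> w)" if q: "q \<in> Q" and w: "w \<in> carrier W" for q w
    proof -
      obtain l where l: "l \<in> L" "w = h (\<pi> w) \<otimes>\<^bsub>W\<^esub> l" using \<pi> w by blast
      have c: "\<pi> w \<in> carrier M" using \<pi> w by auto
      have "ow q w = ow q (h (\<pi> w)) \<otimes>\<^bsub>W\<^esub> ow q l"
        using ow[OF q] l hK[OF c] Kc Lc by (metis hom_mult)
      then have "ow q w = h (om q (\<pi> w)) \<otimes>\<^bsub>W\<^esub> ow q l" using hq c q by simp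
      then show ?thesis using \<pi>I om QL c q l(1) by simp
    qed
    moreover have "\<pi> (h x) = x" if "x \<in> carrier M" for x
      using \<pi>I[OF that subgroup.one_closed[OF L]] that hK Kc by simp
    ultimately show ?retract using hq by blast
  qed
  show ?summand if ?retract
  proof -
    from that obtain \<iota> \<pi> where \<iota>: "\<iota> \<in> hom M W" and \<pi>: "\<pi> \<in> hom W M"
      and \<iota>q: "\<forall>q\<in>Q. \<forall>x\<in>carrier M. \<iota> (om q x) = ow q (\<iota> x)"
      and \<pi>q: "\<forall>q\<in>Q. \<forall>w\<in>carrier W. \<pi> (ow q w) = om q (\<pi> w)"
      and \<pi>\<iota>: "\<forall>x\<in>carrier M. \<pi> (\<iota> x) = x"
      by (elim bexE conjE) (rule that)
    interpret \<iota>: group_hom M W \<iota> by unfold_locales (rule \<iota>)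
    interpret \<pi>: group_hom W M \<pi> by unfold_locales (rule \<pi>)
    define K where "K = \<iota> ` carrier M"
    define L where "L = kernel W M \<pi>"
    \<comment> \<open>As \<open>\<pi>\<close> intertwines the actions, operators fix the neutral element of \<open>M\<close>; hence \<open>L\<close> is stable.\<close>
    have om1: "om q \<one>\<^bsub>M\<^esub> = \<one>\<^bsub>M\<^esub>" if q: "q \<in> Q" for q
    proof -
      interpret q: group_hom W W "ow q" by unfold_locales (rule ow[OF q])
      show ?thesis using \<pi>q q by (metis W.one_closed q.hom_one \<pi>.hom_one)
    qed
    have K: "subgroup K W" unfolding K_def by (rule \<iota>.img_is_subgroup)
    have L: "subgroup L W" unfolding L_def by (rule \<pi>.subgroup_kernel)
    have "\<forall>q\<in>Q. \<forall>w\<in>K. ow q w \<in> K" unfolding K_def using \<iota>q om by (metis (no_types, lifting) imageE image_eqI)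
    moreover have "\<forall>q\<in>Q. \<forall>w\<in>L. ow q w \<in> L"
      unfolding L_def kernel_def using \<pi>q om1 hom_in_carrier[OF ow] by auto
    moreover have "K <#>\<^bsub>W\<^esub> L = carrier W"
    proof
      show "K <#>\<^bsub>W\<^esub> L \<subseteq> carrier W" using K L by (simp add: W.set_mult_closed subgroup.subset)
      show "carrier W \<subseteq> K <#>\<^bsub>W\<^esub> L"
      proof
        fix w assume w: "w \<in> carrier W"
        have "w = \<iota> (\<pi> w) \<otimes>\<^bsub>W\<^esub> (inv\<^bsub>W\<^esub> \<iota> (\<pi> w) \<otimes>\<^bsub>W\<^esub> w)"
          using w by (simp flip: W.m_assoc)
        moreover have "inv\<^bsub>W\<^esub> \<iota> (\<pi> w) \<otimes>\<^bsub>W\<^esub> w \<in> L"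
          unfolding L_def kernel_def using w by (simp add: \<pi>\<iota> del: \<iota>.hom_inv)
        moreover have "\<iota> (\<pi> w) \<in> K" unfolding K_def using w by simp
        ultimately show "w \<in> K <#>\<^bsub>W\<^esub> L" unfolding set_mult_def by blast
      qed
    qed
    moreover have "K \<inter> L = {\<one>\<^bsub>W\<^esub>}"
    proof
      show "K \<inter> L \<subseteq> {\<one>\<^bsub>W\<^esub>}" unfolding K_def L_def kernel_def using \<pi>\<iota> by auto
      show "{\<one>\<^bsub>W\<^esub>} \<subseteq> K \<inter> L" using K L by (simp add: subgroup.one_closed)
    qed
    moreover have "\<iota> \<in> iso M (W\<lparr>carrier := K\<rparr>)"
      unfolding iso_def hom_def bij_betw_def K_def using \<pi>\<iota>
      by (auto intro: inj_on_inverseI)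
    ultimately show ?summand using K L \<iota>q by blast
  qed
qed

lemma submodule_iff:
  "submodule H R M \<longleftrightarrow>
     subgroup H (add_monoid M) \<and> (\<forall>r\<in>carrier R. \<forall>x\<in>H. r \<odot>\<^bsub>M\<^esub> x \<in> H)"
  by (auto simp: submodule_def submodule_axioms_def)

lemma ball_Plus: "(\<forall>q\<in>Sum_Type.Plus A B. P q) \<longleftrightarrow> (\<forall>a\<in>A. P (Inl a)) \<and> (\<forall>b\<in>B. P (Inr b))"
  by auto

lemma iso_direct_summand_iff_retract:
  assumes M: "abelian_group M" and W: "abelian_group W"
    and closed: "\<And>r x. r \<in> carrier R \<Longrightarrow> x \<in> carrier M \<Longrightarrow> r \<odot>\<^bsub>M\<^esub> x \<in> carrier M"
    and additive: "\<And>r. r \<in> carrier R \<Longrightarrow> (\<lambda>w. r \<odot>\<^bsub>W\<^esub> w) \<in> hom (add_monoid W) (add_monoid W)"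
  shows "iso_direct_summand R M W \<longleftrightarrow>
    (\<exists>\<iota>\<in>hom (add_monoid M) (add_monoid W). \<exists>\<pi>\<in>hom (add_monoid W) (add_monoid M).
       (\<forall>r\<in>carrier R. \<forall>x\<in>carrier M. \<iota> (r \<odot>\<^bsub>M\<^esub> x) = r \<odot>\<^bsub>W\<^esub> \<iota> x) \<and>
       (\<forall>r\<in>carrier R. \<forall>w\<in>carrier W. \<pi> (r \<odot>\<^bsub>W\<^esub> w) = r \<odot>\<^bsub>M\<^esub> \<pi> w) \<and>
       (\<forall>x\<in>carrier M. \<pi> (\<iota> x) = x))"
  using direct_summand_iff_retract[of "add_monoid M" "add_monoid W" "carrier R" "smult M" "smult W"]
    abelian_group.a_comm_group[OF M] abelian_group.a_comm_group[OF W] closed additive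
  by (simp add: iso_direct_summand_def submodule_iff module_isomorphic_def
      set_add_def)

lemma bimodule_iso_direct_summand_iff_retract:
  assumes M: "abelian_group M" and W: "abelian_group W"
    and closed: "\<And>r x. r \<in> carrier R \<Longrightarrow> x \<in> carrier M \<Longrightarrow> r \<odot>\<^bsub>M\<^esub> x \<in> carrier M"
      "\<And>s x. s \<in> carrier S \<Longrightarrow> x \<in> carrier M \<Longrightarrow> rsmult M x s \<in> carrier M"
    and additive: "\<And>r. r \<in> carrier R \<Longrightarrow> (\<lambda>w. r \<odot>\<^bsub>W\<^esub> w) \<in> hom (add_monoid W) (add_monoid W)"
      "\<And>s. s \<in> carrier S \<Longrightarrow> (\<lambda>w. rsmult W w s) \<in> hom (add_monoid W) (add_monoid W)"
  shows "bimodule_iso_direct_summand R S M W \<longleftrightarrow>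
    (\<exists>\<iota>\<in>hom (add_monoid M) (add_monoid W). \<exists>\<pi>\<in>hom (add_monoid W) (add_monoid M).
       (\<forall>r\<in>carrier R. \<forall>x\<in>carrier M. \<iota> (r \<odot>\<^bsub>M\<^esub> x) = r \<odot>\<^bsub>W\<^esub> \<iota> x) \<and>
       (\<forall>s\<in>carrier S. \<forall>x\<in>carrier M. \<iota> (rsmult M x s) = rsmult W (\<iota> x) s) \<and>
       (\<forall>r\<in>carrier R. \<forall>w\<in>carrier W. \<pi> (r \<odot>\<^bsub>W\<^esub> w) = r \<odot>\<^bsub>M\<^esub> \<pi> w) \<and>
       (\<forall>s\<in>carrier S. \<forall>w\<in>carrier W. \<pi> (rsmult W w s) = rsmult M (\<pi> w) s) \<and>
       (\<forall>x\<in>carrier M. \<pi> (\<iota> x) = x))"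
proof -
  interpret M: abelian_group M by (rule M)
  interpret W: abelian_group W by (rule W)
  let ?om = "case_sum (smult M) (\<lambda>s x. rsmult M x s)"
    and ?ow = "case_sum (smult W) (\<lambda>s x. rsmult W x s)"
  have "?om q x \<in> carrier M"
    if "q \<in> Sum_Type.Plus (carrier R) (carrier S)" "x \<in> carrier (add_monoid M)" for q x
    using that closed by auto
  moreover have "?ow q \<in> hom (add_monoid W) (add_monoid W)"
    if "q \<in> Sum_Type.Plus (carrier R) (carrier S)" for q
    using that additive by auto
  ultimately show ?thesis
    using direct_summand_iff_retract[OF M.a_comm_group W.a_comm_group,
        of "Sum_Type.Plus (carrier R) (carrier S)" ?om ?ow]
    by (simp add: bimodule_iso_direct_summand_def subbimodule_def submodule_iff
      bimodule_isomorphic_def set_add_def ball_Plus)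
qed

section \<open>Left modules and dual bases\<close>

lemma hom_finsum:
  assumes "abelian_group M" "abelian_group N" and h: "h \<in> hom (add_monoid M) (add_monoid N)"
    and "f \<in> F \<rightarrow> carrier M"
  shows "h (\<Oplus>\<^bsub>M\<^esub>i\<in>F. f i) = (\<Oplus>\<^bsub>N\<^esub>i\<in>F. h (f i))"
proof -
  interpret M: abelian_group M by fact
  interpret N: abelian_group N by fact
  have h0: "h \<zero>\<^bsub>M\<^esub> = \<zero>\<^bsub>N\<^esub>"
    using hom_one[OF h M.a_group N.a_group] by simp
  have hc: "h x \<in> carrier N" if "x \<in> carrier M" for x
    using hom_in_carrier[OF h] that by simp
  have ha: "h (x \<oplus>\<^bsub>M\<^esub> y) = h x \<oplus>\<^bsub>N\<^esub> h y" if "x \<in> carrier M" "y \<in> carrier M" for x y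
    using hom_mult[OF h] that by simp
  show ?thesis using assms(4)
  proof (induction F rule: infinite_finite_induct)
    case (insert i F)
    then have "f \<in> F \<rightarrow> carrier M" "f i \<in> carrier M" "(\<lambda>i. h (f i)) \<in> F \<rightarrow> carrier N"
      using hc by auto
    then show ?case using insert hc by (simp add: ha)
  qed (simp_all add: h0)
qed

text \<open>
  The axioms of \<^locale>\<open>module\<close> over a ring that may be noncommutative, as \<open>A\<close> and its centralizer
  \<open>V\<close> usually are.
\<close>
locale left_module = R?: ring R + M?: abelian_group M 
  for R :: "('r, 'x) ring_scheme" (structure) and M :: "('r, 'm, 'y) module_scheme" (structure) +
  assumes smult_closed [simp, intro]:
      "\<lbrakk>r \<in> carrier R; x \<in> carrier M\<rbrakk> \<Longrightarrow> r \<odot>\<^bsub>M\<^esub> x \<in> carrier M"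
    and smult_l_distr:
      "\<lbrakk>r \<in> carrier R; s \<in> carrier R; x \<in> carrier M\<rbrakk> \<Longrightarrow>
         (r \<oplus>\<^bsub>R\<^esub> s) \<odot>\<^bsub>M\<^esub> x = r \<odot>\<^bsub>M\<^esub> x \<oplus>\<^bsub>M\<^esub> s \<odot>\<^bsub>M\<^esub> x"
    and smult_r_distr:
      "\<lbrakk>r \<in> carrier R; x \<in> carrier M; y \<in> carrier M\<rbrakk> \<Longrightarrow>
         r \<odot>\<^bsub>M\<^esub> (x \<oplus>\<^bsub>M\<^esub> y) = r \<odot>\<^bsub>M\<^esub> x \<oplus>\<^bsub>M\<^esub> r \<odot>\<^bsub>M\<^esub> y"
    and smult_assoc:
      "\<lbrakk>r \<in> carrier R; s \<in> carrier R; x \<in> carrier M\<rbrakk> \<Longrightarrow>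
         (r \<otimes>\<^bsub>R\<^esub> s) \<odot>\<^bsub>M\<^esub> x = r \<odot>\<^bsub>M\<^esub> (s \<odot>\<^bsub>M\<^esub> x)"
    and smult_one [simp]: "x \<in> carrier M \<Longrightarrow> \<one>\<^bsub>R\<^esub> \<odot>\<^bsub>M\<^esub> x = x"
begin

lemma smult_additive: "r \<in> carrier R \<Longrightarrow> (\<lambda>x. r \<odot>\<^bsub>M\<^esub> x) \<in> hom (add_monoid M) (add_monoid M)"
  by (auto simp: hom_def smult_r_distr)

lemma scalar_additive: "x \<in> carrier M \<Longrightarrow> (\<lambda>r. r \<odot>\<^bsub>M\<^esub> x) \<in> hom (add_monoid R) (add_monoid M)"
  by (auto simp: hom_def smult_l_distr)

lemma smult_l_null [simp]: "x \<in> carrier M \<Longrightarrow> \<zero>\<^bsub>R\<^esub> \<odot>\<^bsub>M\<^esub> x = \<zero>\<^bsub>M\<^esub>"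
  using hom_one[OF scalar_additive R.a_group M.a_group] by simp

lemma smult_r_null [simp]: "r \<in> carrier R \<Longrightarrow> r \<odot>\<^bsub>M\<^esub> \<zero>\<^bsub>M\<^esub> = \<zero>\<^bsub>M\<^esub>"
  using hom_one[OF smult_additive M.a_group M.a_group] by simp

lemma finsum_smult:
  "r \<in> carrier R \<Longrightarrow> f \<in> F \<rightarrow> carrier M \<Longrightarrow>
    r \<odot>\<^bsub>M\<^esub> (\<Oplus>\<^bsub>M\<^esub>i\<in>F. f i) = (\<Oplus>\<^bsub>M\<^esub>i\<in>F. r \<odot>\<^bsub>M\<^esub> f i)"
  by (rule hom_finsum[OF M.abelian_group_axioms M.abelian_group_axioms smult_additive])

lemma finsum_scalar:
  "x \<in> carrier M \<Longrightarrow> f \<in> F \<rightarrow> carrier R \<Longrightarrow>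
    (\<Oplus>\<^bsub>R\<^esub>i\<in>F. f i) \<odot>\<^bsub>M\<^esub> x = (\<Oplus>\<^bsub>M\<^esub>i\<in>F. f i \<odot>\<^bsub>M\<^esub> x)"
  by (rule hom_finsum[OF R.abelian_group_axioms M.abelian_group_axioms scalar_additive])

end

lemma left_module_free_module:
  assumes "ring R"
  shows "left_module R (free_module R I)"
proof -
  interpret R: ring R by fact
  let ?W = "free_module R I"
  have fin: "finite {i \<in> I. h i \<noteq> \<zero>\<^bsub>R\<^esub>}"
    if "finite {i \<in> I. f i \<noteq> \<zero>\<^bsub>R\<^esub>}" "finite {i \<in> I. g i \<noteq> \<zero>\<^bsub>R\<^esub>}"
      "\<And>i. f i = \<zero>\<^bsub>R\<^esub> \<Longrightarrow> g i = \<zero>\<^bsub>R\<^esub> \<Longrightarrow> h i = \<zero>\<^bsub>R\<^esub>" for f g h :: "'c \<Rightarrow> 'a"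
    by (rule finite_subset[OF _ finite_UnI[OF that(1,2)]]) (use that(3) in auto)
  have restr: "(\<lambda>i\<in>I. f i) \<in> carrier ?W"
    if "f \<in> I \<rightarrow> carrier R" "finite {i \<in> I. f i \<noteq> \<zero>\<^bsub>R\<^esub>}" for f
    using that by (auto simp: free_module_def cong: conj_cong)
  have W: "u i \<in> carrier R" if "u \<in> carrier ?W" "i \<in> I" for u i
    using that by (auto simp: free_module_def PiE_def Pi_def)
  have Wfin: "finite {i \<in> I. u i \<noteq> \<zero>\<^bsub>R\<^esub>}" if "u \<in> carrier ?W" for u
    using that by (auto simp: free_module_def)
  have ext: "u = v" if "u \<in> carrier ?W" "v \<in> carrier ?W" "\<And>i. i \<in> I \<Longrightarrow> u i = v i" for u v
    using that by (auto simp: free_module_def intro: PiE_ext)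
  have add: "u \<oplus>\<^bsub>?W\<^esub> v \<in> carrier ?W" if "u \<in> carrier ?W" "v \<in> carrier ?W" for u v
  proof -
    have "(\<lambda>i\<in>I. u i \<oplus>\<^bsub>R\<^esub> v i) \<in> carrier ?W"
      by (rule restr) (use that W in \<open>auto intro!: fin[OF Wfin[OF that(1)] Wfin[OF that(2)]]\<close>)
    then show ?thesis by (simp add: free_module_def)
  qed
  have addi: "(u \<oplus>\<^bsub>?W\<^esub> v) i = u i \<oplus>\<^bsub>R\<^esub> v i" if "i \<in> I" for u v i
    using that by (simp add: free_module_def)
  have smult: "r \<odot>\<^bsub>?W\<^esub> u \<in> carrier ?W" if "r \<in> carrier R" "u \<in> carrier ?W" for r u
  proof -
    have "(\<lambda>i\<in>I. r \<otimes>\<^bsub>R\<^esub> u i) \<in> carrier ?W"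
      by (rule restr) (use that W in \<open>auto intro!: fin[OF Wfin[OF that(2)] Wfin[OF that(2)]]\<close>)
    then show ?thesis by (simp add: free_module_def)
  qed
  have smulti: "(r \<odot>\<^bsub>?W\<^esub> u) i = r \<otimes>\<^bsub>R\<^esub> u i" if "i \<in> I" for r u i
    using that by (simp add: free_module_def)
  have zero: "\<zero>\<^bsub>?W\<^esub> \<in> carrier ?W" using restr[of "\<lambda>_. \<zero>\<^bsub>R\<^esub>"] by (auto simp: free_module_def)
  have zeroi: "\<zero>\<^bsub>?W\<^esub> i = \<zero>\<^bsub>R\<^esub>" if "i \<in> I" for i using that by (simp add: free_module_def)
  note simps = add addi smult smulti zero zeroi W
  have minus: "\<exists>v\<in>carrier ?W. v \<oplus>\<^bsub>?W\<^esub> u = \<zero>\<^bsub>?W\<^esub>" if u: "u \<in> carrier ?W" for u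
  proof
    let ?v = "(\<ominus>\<^bsub>R\<^esub> \<one>\<^bsub>R\<^esub>) \<odot>\<^bsub>?W\<^esub> u"
    show "?v \<in> carrier ?W" using u by (simp add: smult)
    show "?v \<oplus>\<^bsub>?W\<^esub> u = \<zero>\<^bsub>?W\<^esub>" by (rule ext) (use u in \<open>auto simp: simps R.l_minus R.l_neg\<close>)
  qed
  have group: "abelian_group ?W"
    by (rule abelian_groupI; (rule ext)?) (auto simp: simps R.a_ac intro: minus)
  show ?thesis
    by (intro left_module.intro left_module_axioms.intro assms group; (rule ext)?)
      (auto simp: simps R.l_distr R.r_distr R.m_assoc)
qed

definition unit_vector :: "('r, 'x) ring_scheme \<Rightarrow> 'i set \<Rightarrow> 'i \<Rightarrow> 'i \<Rightarrow> 'r" where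
  "unit_vector R I i = (\<lambda>j\<in>I. if j = i then \<one>\<^bsub>R\<^esub> else \<zero>\<^bsub>R\<^esub>)"

lemma unit_vector_closed: "ring R \<Longrightarrow> unit_vector R I i \<in> carrier (free_module R I)"
proof -
  assume "ring R"
  then interpret R: ring R .
  have "{j \<in> I. unit_vector R I i j \<noteq> \<zero>\<^bsub>R\<^esub>} \<subseteq> {i}" by (auto simp: unit_vector_def)
  then have "finite {j \<in> I. unit_vector R I i j \<noteq> \<zero>\<^bsub>R\<^esub>}" by (rule finite_subset) simp
  then show ?thesis by (auto simp: free_module_def unit_vector_def)
qed

lemma free_module_component_closed:
  "u \<in> carrier (free_module R I) \<Longrightarrow> i \<in> I \<Longrightarrow> u i \<in> carrier R"
  by (auto simp: free_module_def)

context left_module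
begin

text \<open>
  A linear map on a free module is determined by its values on unit vectors. The basis may be
  infinite; the sum runs over any finite set that contains the support of \<open>u\<close>.
\<close>
lemma free_module_hom_expand:
  assumes h: "h \<in> hom (add_monoid (free_module R I)) (add_monoid M)"
    and lin: "\<And>r u. r \<in> carrier R \<Longrightarrow> u \<in> carrier (free_module R I) \<Longrightarrow>
               h (r \<odot>\<^bsub>free_module R I\<^esub> u) = r \<odot>\<^bsub>M\<^esub> h u"
    and "finite F" "F \<subseteq> I" "u \<in> carrier (free_module R I)" "\<And>i. i \<in> I - F \<Longrightarrow> u i = \<zero>\<^bsub>R\<^esub>"
  shows "h u = (\<Oplus>\<^bsub>M\<^esub>i\<in>F. u i \<odot>\<^bsub>M\<^esub> h (unit_vector R I i))"
  using assms(3-)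
proof (induction F arbitrary: u)
  interpret W: left_module R "free_module R I"
    by (rule left_module_free_module) (rule R.ring_axioms)
  {
    case empty
    then have "u = \<zero>\<^bsub>free_module R I\<^esub>"
      by (auto simp: free_module_def PiE_def extensional_def restrict_def)
    then show ?case using hom_one[OF h W.a_group M.a_group] by simp
  next
    case (insert i F)
    let ?W = "free_module R I" and ?e = "unit_vector R I"
    \<comment> \<open>Split off the \<open>i\<close>-th coordinate: \<open>v\<close> is supported in \<open>F\<close>.\<close>
    define v where "v = (\<lambda>j\<in>I. if j = i then \<zero>\<^bsub>R\<^esub> else u j)"
    have comp: "\<And>j. j \<in> I \<Longrightarrow> u j \<in> carrier R"
      using insert.prems by (auto simp: free_module_def)
    have "{j \<in> I. v j \<noteq> \<zero>\<^bsub>R\<^esub>} \<subseteq> {j \<in> I. u j \<noteq> \<zero>\<^bsub>R\<^esub>}" by (auto simp: v_def)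
    then have "finite {j \<in> I. v j \<noteq> \<zero>\<^bsub>R\<^esub>}"
      by (rule finite_subset) (use insert.prems in \<open>auto simp: free_module_def\<close>)
    then have v: "v \<in> carrier ?W" using comp by (auto simp: free_module_def v_def)
    have e: "?e j \<in> carrier ?W" for j by (rule unit_vector_closed) (rule R.ring_axioms)
    have i: "i \<in> I" using insert.prems by auto
    have "u = u i \<odot>\<^bsub>?W\<^esub> ?e i \<oplus>\<^bsub>?W\<^esub> v"
    proof
      fix j
      show "u j = (u i \<odot>\<^bsub>?W\<^esub> ?e i \<oplus>\<^bsub>?W\<^esub> v) j"
        using comp i insert.prems
        by (auto simp: free_module_def unit_vector_def v_def PiE_def extensional_def)
    qed
    then have "h u = h (u i \<odot>\<^bsub>?W\<^esub> ?e i \<oplus>\<^bsub>?W\<^esub> v)" by simp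
    also have "\<dots> = u i \<odot>\<^bsub>M\<^esub> h (?e i) \<oplus>\<^bsub>M\<^esub> h v"
      using hom_mult[OF h] comp[OF i] e v by (simp add: lin)
    also have "h v = (\<Oplus>\<^bsub>M\<^esub>j\<in>F. v j \<odot>\<^bsub>M\<^esub> h (?e j))"
      by (intro insert.IH; (rule v)?) (use insert.prems in \<open>auto simp: v_def\<close>)
    also have "\<dots> = (\<Oplus>\<^bsub>M\<^esub>j\<in>F. u j \<odot>\<^bsub>M\<^esub> h (?e j))"
      using insert comp hom_in_carrier[OF h] e by (intro M.finsum_cong') (auto simp: v_def)
    also have "u i \<odot>\<^bsub>M\<^esub> h (?e i) \<oplus>\<^bsub>M\<^esub> (\<Oplus>\<^bsub>M\<^esub>j\<in>F. u j \<odot>\<^bsub>M\<^esub> h (?e j))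
        = (\<Oplus>\<^bsub>M\<^esub>j\<in>insert i F. u j \<odot>\<^bsub>M\<^esub> h (?e j))"
      using insert comp hom_in_carrier[OF h] e by (subst M.finsum_insert) auto
    finally show ?case .
  }
qed

text \<open>
  The index set is kept apart from the module, so that the same notion serves for the coordinates of
  \<open>A\<^sup>N\<close> (indexed by numbers) and for generating subsets of \<open>M\<close>.
\<close>
definition dual_basis :: "'i set \<Rightarrow> ('i \<Rightarrow> 'm) \<Rightarrow> ('i \<Rightarrow> 'm \<Rightarrow> 'r) \<Rightarrow> bool" where
  "dual_basis F t g \<longleftrightarrow> finite F \<and> t \<in> F \<rightarrow> carrier M \<and>
     (\<forall>i\<in>F. g i \<in> hom (add_monoid M) (add_monoid R) \<and>
        (\<forall>r\<in>carrier R. \<forall>x\<in>carrier M. g i (r \<odot>\<^bsub>M\<^esub> x) = r \<otimes>\<^bsub>R\<^esub> g i x)) \<and>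
     (\<forall>x\<in>carrier M. (\<Oplus>\<^bsub>M\<^esub>i\<in>F. g i x \<odot>\<^bsub>M\<^esub> t i) = x)"

text \<open>
  A retract of a free module of infinite rank still has a finite dual basis if the image of \<open>\<iota>\<close>
  involves only finitely many coordinates.
\<close>
lemma dual_basis_of_retract:
  assumes \<iota>: "\<iota> \<in> hom (add_monoid M) (add_monoid (free_module R I))"
    and \<pi>: "\<pi> \<in> hom (add_monoid (free_module R I)) (add_monoid M)"
    and \<iota>_lin: "\<And>r x. r \<in> carrier R \<Longrightarrow> x \<in> carrier M \<Longrightarrow>
                 \<iota> (r \<odot>\<^bsub>M\<^esub> x) = r \<odot>\<^bsub>free_module R I\<^esub> \<iota> x"
    and \<pi>_lin: "\<And>r u. r \<in> carrier R \<Longrightarrow> u \<in> carrier (free_module R I) \<Longrightarrow>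
                 \<pi> (r \<odot>\<^bsub>free_module R I\<^esub> u) = r \<odot>\<^bsub>M\<^esub> \<pi> u"
    and \<pi>\<iota>: "\<And>x. x \<in> carrier M \<Longrightarrow> \<pi> (\<iota> x) = x"
    and F: "finite F" "F \<subseteq> I"
    and supp: "\<And>x i. x \<in> carrier M \<Longrightarrow> i \<in> I - F \<Longrightarrow> \<iota> x i = \<zero>\<^bsub>R\<^esub>"
  shows "dual_basis F (\<lambda>i. \<pi> (unit_vector R I i)) (\<lambda>i x. \<iota> x i)"
  unfolding dual_basis_def
proof (intro conjI ballI funcsetI)
  have \<iota>c: "\<iota> x \<in> carrier (free_module R I)" if "x \<in> carrier M" for x
    using hom_in_carrier[OF \<iota>] that by simp
  show "\<pi> (unit_vector R I i) \<in> carrier M" for i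
    using hom_in_carrier[OF \<pi>] unit_vector_closed[OF R.ring_axioms, of I i] by simp
  show "(\<lambda>x. \<iota> x i) \<in> hom (add_monoid M) (add_monoid R)" if i: "i \<in> F" for i
  proof (rule homI)
    show "\<iota> x i \<in> carrier (add_monoid R)" if "x \<in> carrier (add_monoid M)" for x
      using free_module_component_closed[OF \<iota>c] that i F by auto
    show "\<iota> (x \<otimes>\<^bsub>add_monoid M\<^esub> y) i = \<iota> x i \<otimes>\<^bsub>add_monoid R\<^esub> \<iota> y i"
      if "x \<in> carrier (add_monoid M)" "y \<in> carrier (add_monoid M)" for x y
      using hom_mult[OF \<iota> that] i F by (auto simp: free_module_def)
  qed
  show "\<iota> (r \<odot>\<^bsub>M\<^esub> x) i = r \<otimes>\<^bsub>R\<^esub> \<iota> x i" if "i \<in> F" "r \<in> carrier R" "x \<in> carrier M" for i r x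
    using \<iota>_lin[OF that(2,3)] that(1) F by (auto simp: free_module_def)
  show "(\<Oplus>\<^bsub>M\<^esub>i\<in>F. \<iota> x i \<odot>\<^bsub>M\<^esub> \<pi> (unit_vector R I i)) = x" if "x \<in> carrier M" for x
    using free_module_hom_expand[OF \<pi> \<pi>_lin F \<iota>c supp] \<pi>\<iota> that by simp
qed (rule F)

lemma retract_of_dual_basis:
  assumes "dual_basis F t g"
  defines "\<iota> \<equiv> \<lambda>x. \<lambda>i\<in>F. g i x" and "\<pi> \<equiv> \<lambda>u. \<Oplus>\<^bsub>M\<^esub>i\<in>F. u i \<odot>\<^bsub>M\<^esub> t i"
  shows "\<iota> \<in> hom (add_monoid M) (add_monoid (free_module R F))" (is ?a)
    and "\<pi> \<in> hom (add_monoid (free_module R F)) (add_monoid M)" (is ?b)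
    and "r \<in> carrier R \<Longrightarrow> x \<in> carrier M \<Longrightarrow> \<iota> (r \<odot>\<^bsub>M\<^esub> x) = r \<odot>\<^bsub>free_module R F\<^esub> \<iota> x"
    and "r \<in> carrier R \<Longrightarrow> u \<in> carrier (free_module R F) \<Longrightarrow>
           \<pi> (r \<odot>\<^bsub>free_module R F\<^esub> u) = r \<odot>\<^bsub>M\<^esub> \<pi> u"
    and "x \<in> carrier M \<Longrightarrow> \<pi> (\<iota> x) = x"
proof -
  have F: "finite F" and t: "\<And>i. i \<in> F \<Longrightarrow> t i \<in> carrier M"
    and g: "\<And>i. i \<in> F \<Longrightarrow> g i \<in> hom (add_monoid M) (add_monoid R)"
    and glin: "\<And>i r x. i \<in> F \<Longrightarrow> r \<in> carrier R \<Longrightarrow> x \<in> carrier M \<Longrightarrow> g i (r \<odot>\<^bsub>M\<^esub> x) = r \<otimes>\<^bsub>R\<^esub> g i x"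
    and sum: "\<And>x. x \<in> carrier M \<Longrightarrow> (\<Oplus>\<^bsub>M\<^esub>i\<in>F. g i x \<odot>\<^bsub>M\<^esub> t i) = x"
    using assms(1) unfolding dual_basis_def by auto
  have gc: "g i x \<in> carrier R" if "i \<in> F" "x \<in> carrier M" for i x
    using hom_in_carrier[OF g] that by simp
  have uc: "u i \<in> carrier R" if "u \<in> carrier (free_module R F)" "i \<in> F" for u i
    using that by (rule free_module_component_closed)
  show ?a
  proof (rule homI)
    show "\<iota> x \<in> carrier (add_monoid (free_module R F))" if "x \<in> carrier (add_monoid M)" for x
      using F gc that by (auto simp: \<iota>_def free_module_def)
    show "\<iota> (x \<otimes>\<^bsub>add_monoid M\<^esub> y) = \<iota> x \<otimes>\<^bsub>add_monoid (free_module R F)\<^esub> \<iota> y"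
      if "x \<in> carrier (add_monoid M)" "y \<in> carrier (add_monoid M)" for x y
      using hom_mult[OF g that] by (auto simp: \<iota>_def free_module_def intro!: restrict_ext)
  qed
  show ?b
  proof (rule homI)
    show "\<pi> u \<in> carrier (add_monoid M)" if "u \<in> carrier (add_monoid (free_module R F))" for u
      using that t uc[of u] by (auto simp: \<pi>_def intro!: M.finsum_closed)
    show "\<pi> (u \<otimes>\<^bsub>add_monoid (free_module R F)\<^esub> v) = \<pi> u \<otimes>\<^bsub>add_monoid M\<^esub> \<pi> v"
      if "u \<in> carrier (add_monoid (free_module R F))" "v \<in> carrier (add_monoid (free_module R F))" for u v
    proof -
      have "\<pi> (u \<otimes>\<^bsub>add_monoid (free_module R F)\<^esub> v)
          = (\<Oplus>\<^bsub>M\<^esub>i\<in>F. u i \<odot>\<^bsub>M\<^esub> t i \<oplus>\<^bsub>M\<^esub> v i \<odot>\<^bsub>M\<^esub> t i)"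
        unfolding \<pi>_def using that t uc[of u] uc[of v]
        by (intro M.finsum_cong') (auto simp: free_module_def smult_l_distr)
      also have "\<dots> = \<pi> u \<oplus>\<^bsub>M\<^esub> \<pi> v"
        unfolding \<pi>_def using that t uc[of u] uc[of v] by (intro M.finsum_addf) auto
      finally show ?thesis by simp
    qed
  qed
  show "\<iota> (r \<odot>\<^bsub>M\<^esub> x) = r \<odot>\<^bsub>free_module R F\<^esub> \<iota> x" if "r \<in> carrier R" "x \<in> carrier M" for r x
    using glin that by (auto simp: \<iota>_def free_module_def intro!: restrict_ext)
  show "\<pi> (r \<odot>\<^bsub>free_module R F\<^esub> u) = r \<odot>\<^bsub>M\<^esub> \<pi> u"
    if "r \<in> carrier R" "u \<in> carrier (free_module R F)" for r u
  proof -
    have "\<pi> (r \<odot>\<^bsub>free_module R F\<^esub> u) = (\<Oplus>\<^bsub>M\<^esub>i\<in>F. r \<odot>\<^bsub>M\<^esub> (u i \<odot>\<^bsub>M\<^esub> t i))"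
      unfolding \<pi>_def using that t uc[of u]
      by (intro M.finsum_cong') (auto simp: free_module_def smult_assoc)
    also have "\<dots> = r \<odot>\<^bsub>M\<^esub> \<pi> u"
      unfolding \<pi>_def using that t uc[of u] by (intro finsum_smult[symmetric]) auto
    finally show ?thesis .
  qed
  show "\<pi> (\<iota> x) = x" if "x \<in> carrier M" for x
  proof -
    have "\<pi> (\<iota> x) = (\<Oplus>\<^bsub>M\<^esub>i\<in>F. g i x \<odot>\<^bsub>M\<^esub> t i)"
      unfolding \<pi>_def using that t gc by (intro M.finsum_cong') (auto simp: \<iota>_def)
    then show ?thesis using sum that by simp
  qed
qed

text \<open>
  Merging the functionals that belong to the same element turns a dual basis with any index set into
  one indexed by a subset of \<open>M\<close>. This matters because \<^const>\<open>projective_module\<close> takes its bases from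
  the element type of \<open>M\<close>, which may have fewer elements than the given index set.
\<close>
lemma dual_basis_collapse:
  assumes "dual_basis F t g"
  shows "dual_basis (t ` F) (\<lambda>y. y) (\<lambda>y x. \<Oplus>\<^bsub>R\<^esub>i\<in>{i\<in>F. t i = y}. g i x)"
  unfolding dual_basis_def
proof (intro conjI ballI funcsetI)
  have F: "finite F" and t: "\<And>i. i \<in> F \<Longrightarrow> t i \<in> carrier M"
    and g: "\<And>i. i \<in> F \<Longrightarrow> g i \<in> hom (add_monoid M) (add_monoid R)"
    and glin: "\<And>i r x. i \<in> F \<Longrightarrow> r \<in> carrier R \<Longrightarrow> x \<in> carrier M \<Longrightarrow> g i (r \<odot>\<^bsub>M\<^esub> x) = r \<otimes>\<^bsub>R\<^esub> g i x"
    and sum: "\<And>x. x \<in> carrier M \<Longrightarrow> (\<Oplus>\<^bsub>M\<^esub>i\<in>F. g i x \<odot>\<^bsub>M\<^esub> t i) = x"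
    using assms(1) unfolding dual_basis_def by auto
  have gc: "g i x \<in> carrier R" if "i \<in> F" "x \<in> carrier M" for i x
    using hom_in_carrier[OF g] that by simp
  let ?fib = "\<lambda>y. {i\<in>F. t i = y}"
  let ?g = "\<lambda>y x. \<Oplus>\<^bsub>R\<^esub>i\<in>?fib y. g i x"
  show "finite (t ` F)" using F by simp
  show "y \<in> carrier M" if "y \<in> t ` F" for y using that t by auto
  show "?g y \<in> hom (add_monoid M) (add_monoid R)" for y
  proof (rule homI)
    show "?g y x \<in> carrier (add_monoid R)" if "x \<in> carrier (add_monoid M)" for x
      using gc that by (auto intro!: R.finsum_closed)
    show "?g y (x \<otimes>\<^bsub>add_monoid M\<^esub> x') = ?g y x \<otimes>\<^bsub>add_monoid R\<^esub> ?g y x'"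
      if "x \<in> carrier (add_monoid M)" "x' \<in> carrier (add_monoid M)" for x x'
    proof -
      have "?g y (x \<otimes>\<^bsub>add_monoid M\<^esub> x') = (\<Oplus>\<^bsub>R\<^esub>i\<in>?fib y. g i x \<oplus>\<^bsub>R\<^esub> g i x')"
        using hom_mult[OF g that] gc that by (intro R.finsum_cong') auto
      also have "\<dots> = ?g y x \<oplus>\<^bsub>R\<^esub> ?g y x'" using gc that by (intro R.finsum_addf) auto
      finally show ?thesis by simp
    qed
  qed
  show "?g y (r \<odot>\<^bsub>M\<^esub> x) = r \<otimes>\<^bsub>R\<^esub> ?g y x" if "r \<in> carrier R" "x \<in> carrier M" for y r x
  proof -
    have "?g y (r \<odot>\<^bsub>M\<^esub> x) = (\<Oplus>\<^bsub>R\<^esub>i\<in>?fib y. r \<otimes>\<^bsub>R\<^esub> g i x)"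
      using glin gc that by (intro R.finsum_cong') auto
    also have "\<dots> = r \<otimes>\<^bsub>R\<^esub> ?g y x"
      using F gc that by (intro R.finsum_rdistr[symmetric]) auto
    finally show ?thesis .
  qed
  show "(\<Oplus>\<^bsub>M\<^esub>y\<in>t ` F. ?g y x \<odot>\<^bsub>M\<^esub> y) = x" if x: "x \<in> carrier M" for x
  proof -
    have inner: "?g y x \<odot>\<^bsub>M\<^esub> y = (\<Oplus>\<^bsub>M\<^esub>i\<in>?fib y. g i x \<odot>\<^bsub>M\<^esub> t i)" if y: "y \<in> t ` F" for y
    proof -
      have "?g y x \<odot>\<^bsub>M\<^esub> y = (\<Oplus>\<^bsub>M\<^esub>i\<in>?fib y. g i x \<odot>\<^bsub>M\<^esub> y)"
        using y t gc x by (intro finsum_scalar) auto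
      also have "\<dots> = (\<Oplus>\<^bsub>M\<^esub>i\<in>?fib y. g i x \<odot>\<^bsub>M\<^esub> t i)"
        using t gc x by (intro M.finsum_cong') auto
      finally show ?thesis .
    qed
    have "(\<Oplus>\<^bsub>M\<^esub>y\<in>t ` F. ?g y x \<odot>\<^bsub>M\<^esub> y)
        = (\<Oplus>\<^bsub>M\<^esub>y\<in>t ` F. \<Oplus>\<^bsub>M\<^esub>i\<in>?fib y. g i x \<odot>\<^bsub>M\<^esub> t i)"
      using inner t gc x by (intro M.finsum_cong') (auto intro!: M.finsum_closed)
    also have "\<dots> = (\<Oplus>\<^bsub>M\<^esub>i\<in>(\<Union>y\<in>t ` F. ?fib y). g i x \<odot>\<^bsub>M\<^esub> t i)"
      by (rule M.add.finprod_UN_disjoint[symmetric])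
        (use F t gc x in \<open>auto simp: pairwise_def disjnt_def\<close>)
    also have "(\<Union>y\<in>t ` F. ?fib y) = F" by auto
    finally show ?thesis using sum[OF x] by simp
  qed
qed

text \<open>
  The dual basis lemma. Here projectivity provides a free module of unknown rank; finitely many
  generators have supports contained in a finite set, and this set then contains the support of every
  element of the image.
\<close>
theorem finitely_generated_projective_iff_dual_basis:
  "finitely_generated R M \<and> projective_module R M \<longleftrightarrow>
     (\<exists>F (t :: 'm \<Rightarrow> 'm) g. dual_basis F t g)"
proof (intro iffI conjI)
  have add_eq: "iso_direct_summand R M (free_module R I) \<longleftrightarrow>
    (\<exists>\<iota>\<in>hom (add_monoid M) (add_monoid (free_module R I)).
     \<exists>\<pi>\<in>hom (add_monoid (free_module R I)) (add_monoid M).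
       (\<forall>r\<in>carrier R. \<forall>x\<in>carrier M. \<iota> (r \<odot>\<^bsub>M\<^esub> x) = r \<odot>\<^bsub>free_module R I\<^esub> \<iota> x) \<and>
       (\<forall>r\<in>carrier R. \<forall>w\<in>carrier (free_module R I). \<pi> (r \<odot>\<^bsub>free_module R I\<^esub> w) = r \<odot>\<^bsub>M\<^esub> \<pi> w) \<and>
       (\<forall>x\<in>carrier M. \<pi> (\<iota> x) = x))" for I :: "'m set"
  proof -
    interpret W: left_module R "free_module R I"
      by (rule left_module_free_module) (rule R.ring_axioms)
    show ?thesis
      by (rule iso_direct_summand_iff_retract[OF M.abelian_group_axioms W.abelian_group_axioms])
        (simp_all add: W.smult_additive)
  qed
  {
    assume "finitely_generated R M \<and> projective_module R M"
    then obtain S I \<iota> \<pi> where S: "S \<subseteq> carrier M" "finite S"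
      "carrier M = {\<Oplus>\<^bsub>M\<^esub>s\<in>S. a s \<odot>\<^bsub>M\<^esub> s | a. a \<in> S \<rightarrow> carrier R}"
      and \<iota>: "\<iota> \<in> hom (add_monoid M) (add_monoid (free_module R (I :: 'm set)))"
      and \<pi>: "\<pi> \<in> hom (add_monoid (free_module R I)) (add_monoid M)"
      and \<iota>_lin: "\<forall>r\<in>carrier R. \<forall>x\<in>carrier M. \<iota> (r \<odot>\<^bsub>M\<^esub> x) = r \<odot>\<^bsub>free_module R I\<^esub> \<iota> x"
      and \<pi>_lin: "\<forall>r\<in>carrier R. \<forall>w\<in>carrier (free_module R I).
                    \<pi> (r \<odot>\<^bsub>free_module R I\<^esub> w) = r \<odot>\<^bsub>M\<^esub> \<pi> w"
      and \<pi>\<iota>: "\<forall>x\<in>carrier M. \<pi> (\<iota> x) = x"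
      unfolding finitely_generated_def projective_module_def add_eq
      by (elim exE conjE bexE) (rule that)
    interpret W: left_module R "free_module R I"
      by (rule left_module_free_module) (rule R.ring_axioms)
    define F where "F = (\<Union>s\<in>S. {i\<in>I. \<iota> s i \<noteq> \<zero>\<^bsub>R\<^esub>})"
    have \<iota>c: "\<iota> x \<in> carrier (free_module R I)" if "x \<in> carrier M" for x
      using hom_in_carrier[OF \<iota>] that by simp
    have comp: "(\<lambda>u. u i) \<in> hom (add_monoid (free_module R I)) (add_monoid R)" if "i \<in> I" for i
      using that by (auto simp: hom_def free_module_def)
    have "finite F"
      unfolding F_def using S(1,2) \<iota>c by (auto simp: free_module_def)
    moreover have "\<iota> x i = \<zero>\<^bsub>R\<^esub>" if x: "x \<in> carrier M" and i: "i \<in> I - F" for x i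
    proof -
      obtain a where a: "a \<in> S \<rightarrow> carrier R" "x = (\<Oplus>\<^bsub>M\<^esub>s\<in>S. a s \<odot>\<^bsub>M\<^esub> s)"
        using x S(3) by blast
      have "\<iota> x = (\<Oplus>\<^bsub>free_module R I\<^esub>s\<in>S. \<iota> (a s \<odot>\<^bsub>M\<^esub> s))"
        unfolding a(2) using a(1) S(1)
        by (intro hom_finsum[OF M.abelian_group_axioms W.abelian_group_axioms \<iota>]) auto
      moreover have "(\<lambda>s. \<iota> (a s \<odot>\<^bsub>M\<^esub> s)) \<in> S \<rightarrow> carrier (free_module R I)"
        using a(1) S(1) by (auto intro!: \<iota>c)
      ultimately have "\<iota> x i = (\<Oplus>\<^bsub>R\<^esub>s\<in>S. \<iota> (a s \<odot>\<^bsub>M\<^esub> s) i)"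
        using hom_finsum[OF W.abelian_group_axioms R.abelian_group_axioms comp,
            of i "\<lambda>s. \<iota> (a s \<odot>\<^bsub>M\<^esub> s)" S] i by simp
      also have "\<dots> = (\<Oplus>\<^bsub>R\<^esub>s\<in>S. \<zero>\<^bsub>R\<^esub>)"
      proof (rule R.finsum_cong')
        fix s assume s: "s \<in> S"
        then have as: "a s \<in> carrier R" "s \<in> carrier M" using a(1) S(1) by auto
        then have "\<iota> (a s \<odot>\<^bsub>M\<^esub> s) i = a s \<otimes>\<^bsub>R\<^esub> \<iota> s i"
          using \<iota>_lin i by (simp add: free_module_def)
        then show "\<iota> (a s \<odot>\<^bsub>M\<^esub> s) i = \<zero>\<^bsub>R\<^esub>" using s as i by (auto simp: F_def)
      qed auto
      finally show ?thesis by simp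
    qed
    ultimately have "dual_basis F (\<lambda>i. \<pi> (unit_vector R I i)) (\<lambda>i x. \<iota> x i)"
      using \<iota>_lin \<pi>_lin \<pi>\<iota> by (intro dual_basis_of_retract[OF \<iota> \<pi>]) (auto simp: F_def)
    then show "\<exists>F (t :: 'm \<Rightarrow> 'm) g. dual_basis F t g" by blast
  next
    assume "\<exists>F (t :: 'm \<Rightarrow> 'm) g. dual_basis F t g"
    then obtain F and t :: "'m \<Rightarrow> 'm" and g where db: "dual_basis F t g" by blast
    then have F: "finite F" and t: "\<And>i. i \<in> F \<Longrightarrow> t i \<in> carrier M"
      unfolding dual_basis_def by auto
    obtain T g' where db': "dual_basis T (\<lambda>y. y) g'" using dual_basis_collapse[OF db] by blast
    then have T: "finite T" "T \<subseteq> carrier M"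
      and g': "\<And>y. y \<in> T \<Longrightarrow> g' y \<in> hom (add_monoid M) (add_monoid R)"
      and sum: "\<And>x. x \<in> carrier M \<Longrightarrow> (\<Oplus>\<^bsub>M\<^esub>y\<in>T. g' y x \<odot>\<^bsub>M\<^esub> y) = x"
      unfolding dual_basis_def by auto
    have g'c: "g' y x \<in> carrier R" if "y \<in> T" "x \<in> carrier M" for y x
      using hom_in_carrier[OF g'] that by simp
    have "carrier M = {\<Oplus>\<^bsub>M\<^esub>s\<in>T. a s \<odot>\<^bsub>M\<^esub> s | a. a \<in> T \<rightarrow> carrier R}"
    proof (intro equalityI subsetI)
      fix x assume x: "x \<in> carrier M"
      have "(\<lambda>y. g' y x) \<in> T \<rightarrow> carrier R" using g'c x by auto
      then show "x \<in> {\<Oplus>\<^bsub>M\<^esub>s\<in>T. a s \<odot>\<^bsub>M\<^esub> s | a. a \<in> T \<rightarrow> carrier R}"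
        using sum[OF x] by (intro CollectI exI[of _ "\<lambda>y. g' y x"]) simp
    qed (use T in \<open>auto intro!: M.finsum_closed\<close>)
    then show "finitely_generated R M" using T unfolding finitely_generated_def by blast
    show "projective_module R M"
      unfolding projective_module_def add_eq
      by (intro exI[of _ T] bexI[OF _ retract_of_dual_basis(1)[OF db']]
            bexI[OF _ retract_of_dual_basis(2)[OF db']] conjI ballI
            retract_of_dual_basis(3-5)[OF db'])
  }
qed

end

section \<open>Tensor products over noncommutative rings\<close>

definition pure_tensor ::
    "('r, 'x) ring_scheme \<Rightarrow> ('q, 'm, 'r) bimodule \<Rightarrow> ('r, 'n, 'z) module_scheme \<Rightarrow>
     'm \<Rightarrow> 'n \<Rightarrow> ('m \<times> 'n \<Rightarrow>\<^sub>0 int) set" where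
  "pure_tensor R M N m n = tensor_kernel R M N #>\<^bsub>tensor_free M N\<^esub> frag_of (m, n)"

definition balanced_map ::
    "('r, 'x) ring_scheme \<Rightarrow> ('q, 'm, 'r) bimodule \<Rightarrow> ('r, 'n, 'z) module_scheme \<Rightarrow>
     ('g, 'w) monoid_scheme \<Rightarrow> ('m \<Rightarrow> 'n \<Rightarrow> 'g) \<Rightarrow> bool" where
  "balanced_map R M N G b \<longleftrightarrow>
     (\<forall>m\<in>carrier M. \<forall>n\<in>carrier N. b m n \<in> carrier G) \<and>
     (\<forall>m\<in>carrier M. \<forall>m'\<in>carrier M. \<forall>n\<in>carrier N. b (m \<oplus>\<^bsub>M\<^esub> m') n = b m n \<otimes>\<^bsub>G\<^esub> b m' n) \<and>
     (\<forall>m\<in>carrier M. \<forall>n\<in>carrier N. \<forall>n'\<in>carrier N. b m (n \<oplus>\<^bsub>N\<^esub> n') = b m n \<otimes>\<^bsub>G\<^esub> b m n') \<and>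
     (\<forall>m\<in>carrier M. \<forall>r\<in>carrier R. \<forall>n\<in>carrier N. b (rsmult M m r) n = b m (r \<odot>\<^bsub>N\<^esub> n))"

locale tensor_factors = M: abelian_group M + N: abelian_group N
  for R :: "('r, 'x) ring_scheme" and M :: "('q, 'm, 'r) bimodule"
    and N :: "('r, 'n, 'z) module_scheme" +
  assumes rsmult_closed: "\<lbrakk>m \<in> carrier M; r \<in> carrier R\<rbrakk> \<Longrightarrow> rsmult M m r \<in> carrier M"
    and smult_closed: "\<lbrakk>r \<in> carrier R; n \<in> carrier N\<rbrakk> \<Longrightarrow> r \<odot>\<^bsub>N\<^esub> n \<in> carrier N"
begin

abbreviation "F \<equiv> tensor_free M N"
abbreviation "K \<equiv> tensor_kernel R M N"
abbreviation "T \<equiv> tensor_group R M N"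
abbreviation "pure \<equiv> pure_tensor R M N"

lemma comm_group_F: "comm_group F"
  unfolding tensor_free_def by (rule abelian_free_Abelian_group)

lemma carrier_F: "carrier F = {x. Poly_Mapping.keys x \<subseteq> carrier M \<times> carrier N}"
  by (auto simp: tensor_free_def)

lemma frag_of_in_F: "m \<in> carrier M \<Longrightarrow> n \<in> carrier N \<Longrightarrow> frag_of (m, n) \<in> carrier F"
  by (simp add: tensor_free_def)

lemma diff_in_F: "x \<in> carrier F \<Longrightarrow> y \<in> carrier F \<Longrightarrow> x - y \<in> carrier F"
  using keys_diff[of x y] by (auto simp: carrier_F)

lemma relators_in_F: "tensor_relators R M N \<subseteq> carrier F"
  unfolding tensor_relators_def
  by (auto intro!: diff_in_F frag_of_in_F simp: rsmult_closed smult_closed)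

lemma subgroup_K: "subgroup K F"
  unfolding tensor_kernel_def
  by (rule group.generate_is_subgroup[OF comm_group.axioms(2)[OF comm_group_F] relators_in_F])

lemma normal_K: "K \<lhd> F"
  by (rule comm_group.subgroup_imp_normal[OF comm_group_F subgroup_K])

lemma comm_group_T: "comm_group T"
  unfolding tensor_group_def by (rule comm_group.abelian_FactGroup[OF comm_group_F subgroup_K])

sublocale F: comm_group F by (rule comm_group_F)
sublocale T: comm_group T by (rule comm_group_T)

lemma coset_hom: "(\<lambda>x. K #>\<^bsub>F\<^esub> x) \<in> hom F T"
  unfolding tensor_group_def by (rule normal.r_coset_hom_Mod[OF normal_K])

lemma F_diff: "x \<in> carrier F \<Longrightarrow> y \<in> carrier F \<Longrightarrow> x - y = x \<otimes>\<^bsub>F\<^esub> inv\<^bsub>F\<^esub> y"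
  by (simp add: tensor_free_def)

lemma hom_F_diff:
  assumes G: "comm_group G" and h: "h \<in> hom F G" and "x \<in> carrier F" "y \<in> carrier F"
  shows "h (x - y) = h x \<otimes>\<^bsub>G\<^esub> inv\<^bsub>G\<^esub> h y"
proof -
  interpret G: comm_group G by (rule G)
  interpret h: group_hom F G h by unfold_locales (rule h)
  show ?thesis using assms by (simp add: F_diff)
qed

text \<open>
  Applied in both directions: to the quotient map, it yields that forming pure tensors is balanced,
  and to the homomorphism induced by a balanced map, that it factors through the tensor product.
\<close>
lemma kills_relators_iff_balanced:
  assumes G: "comm_group G" and h: "h \<in> hom F G"
  shows "(\<forall>x\<in>tensor_relators R M N. h x = \<one>\<^bsub>G\<^esub>) \<longleftrightarrow>
    balanced_map R M N G (\<lambda>m n. h (frag_of (m, n)))" (is "_ \<longleftrightarrow> balanced_map R M N G ?b")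
proof -
  interpret G: comm_group G by (rule G)
  have b: "?b m n \<in> carrier G" if "m \<in> carrier M" "n \<in> carrier N" for m n
    using hom_in_carrier[OF h frag_of_in_F] that .
  have diff: "h (x - y) = h x \<otimes>\<^bsub>G\<^esub> inv\<^bsub>G\<^esub> h y" if "x \<in> carrier F" "y \<in> carrier F" for x y
    by (rule hom_F_diff[OF G h that])
  have inv_one: "u \<otimes>\<^bsub>G\<^esub> inv\<^bsub>G\<^esub> v = \<one>\<^bsub>G\<^esub> \<longleftrightarrow> u = v" if "u \<in> carrier G" "v \<in> carrier G" for u v
    using that G.inv_solve_right[of "\<one>\<^bsub>G\<^esub>" u v] by auto
  have inv_two: "u \<otimes>\<^bsub>G\<^esub> inv\<^bsub>G\<^esub> v \<otimes>\<^bsub>G\<^esub> inv\<^bsub>G\<^esub> w = \<one>\<^bsub>G\<^esub> \<longleftrightarrow> u = v \<otimes>\<^bsub>G\<^esub> w"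
    if "u \<in> carrier G" "v \<in> carrier G" "w \<in> carrier G" for u v w
    using that inv_one[of u "v \<otimes>\<^bsub>G\<^esub> w"] by (simp add: G.m_assoc G.inv_mult)
  have 1: "h (frag_of (m \<oplus>\<^bsub>M\<^esub> m', n) - frag_of (m, n) - frag_of (m', n)) = \<one>\<^bsub>G\<^esub> \<longleftrightarrow>
      ?b (m \<oplus>\<^bsub>M\<^esub> m') n = ?b m n \<otimes>\<^bsub>G\<^esub> ?b m' n"
    if "m \<in> carrier M" "m' \<in> carrier M" "n \<in> carrier N" for m m' n
    using that by (simp add: diff diff_in_F frag_of_in_F inv_two b)
  have 2: "h (frag_of (m, n \<oplus>\<^bsub>N\<^esub> n') - frag_of (m, n) - frag_of (m, n')) = \<one>\<^bsub>G\<^esub> \<longleftrightarrow>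
      ?b m (n \<oplus>\<^bsub>N\<^esub> n') = ?b m n \<otimes>\<^bsub>G\<^esub> ?b m n'"
    if "m \<in> carrier M" "n' \<in> carrier N" "n \<in> carrier N" for m n' n
    using that by (simp add: diff diff_in_F frag_of_in_F inv_two b)
  have 3: "h (frag_of (rsmult M m r, n) - frag_of (m, r \<odot>\<^bsub>N\<^esub> n)) = \<one>\<^bsub>G\<^esub> \<longleftrightarrow>
      ?b (rsmult M m r) n = ?b m (r \<odot>\<^bsub>N\<^esub> n)"
    if "m \<in> carrier M" "r \<in> carrier R" "n \<in> carrier N" for m r n
    using that by (simp add: diff frag_of_in_F inv_one b rsmult_closed smult_closed)
  have "(\<forall>x\<in>tensor_relators R M N. h x = \<one>\<^bsub>G\<^esub>) \<longleftrightarrow>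
     (\<forall>m\<in>carrier M. \<forall>m'\<in>carrier M. \<forall>n\<in>carrier N.
        h (frag_of (m \<oplus>\<^bsub>M\<^esub> m', n) - frag_of (m, n) - frag_of (m', n)) = \<one>\<^bsub>G\<^esub>) \<and>
     (\<forall>m\<in>carrier M. \<forall>n\<in>carrier N. \<forall>n'\<in>carrier N.
        h (frag_of (m, n \<oplus>\<^bsub>N\<^esub> n') - frag_of (m, n) - frag_of (m, n')) = \<one>\<^bsub>G\<^esub>) \<and>
     (\<forall>m\<in>carrier M. \<forall>r\<in>carrier R. \<forall>n\<in>carrier N.
        h (frag_of (rsmult M m r, n) - frag_of (m, r \<odot>\<^bsub>N\<^esub> n)) = \<one>\<^bsub>G\<^esub>)"
    unfolding tensor_relators_def ball_Un conj_assoc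
    by (intro arg_cong2[of _ _ _ _ "(\<and>)"]; blast)
  then show ?thesis using b by (simp add: 1 2 3 balanced_map_def)
qed

lemma pure_balanced: "balanced_map R M N T pure"
proof -
  have "K #>\<^bsub>F\<^esub> x = \<one>\<^bsub>T\<^esub>" if "x \<in> tensor_relators R M N" for x
  proof -
    have "x \<in> K" unfolding tensor_kernel_def using that by (rule generate.incl)
    then show ?thesis
      unfolding tensor_group_def using F.coset_join2[OF _ subgroup_K] that relators_in_F by auto
  qed
  then show ?thesis
    using kills_relators_iff_balanced[OF comm_group_T coset_hom] by (simp add: pure_tensor_def[abs_def])
qed

lemma pure_closed [simp]: "m \<in> carrier M \<Longrightarrow> n \<in> carrier N \<Longrightarrow> pure m n \<in> carrier T"
  using pure_balanced unfolding balanced_map_def by blast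

lemma free_hom_eqI:
  assumes G: "comm_group G" and h: "h \<in> hom F G" and k: "k \<in> hom F G"
    and eq: "\<And>m n. m \<in> carrier M \<Longrightarrow> n \<in> carrier N \<Longrightarrow> h (frag_of (m, n)) = k (frag_of (m, n))"
    and x: "x \<in> carrier F"
  shows "h x = k x"
proof -
  interpret G: comm_group G by (rule G)
  have keys: "Poly_Mapping.keys x \<subseteq> carrier M \<times> carrier N" using x by (simp add: carrier_F)
  show ?thesis
  proof (rule free_Abelian_group_induct[OF keys, where P = "\<lambda>x. h x = k x"])
    show "h 0 = k 0"
      using hom_one[OF h F.is_group G.is_group] hom_one[OF k F.is_group G.is_group]
      by (simp add: tensor_free_def)
    show "h (x - y) = k (x - y)"
      if "Poly_Mapping.keys x \<subseteq> carrier M \<times> carrier N" "Poly_Mapping.keys y \<subseteq> carrier M \<times> carrier N"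
        "h x = k x" "h y = k y" for x y
      using that hom_F_diff[OF G h, of x y] hom_F_diff[OF G k, of x y] by (simp add: carrier_F)
  qed (use eq in auto)
qed

text \<open>Pure tensors generate, because the elements \<open>frag_of (m, n)\<close> generate the free group.\<close>
lemma tensor_hom_eqI:
  assumes G: "comm_group G" and h: "h \<in> hom T G" and k: "k \<in> hom T G"
    and eq: "\<And>m n. m \<in> carrier M \<Longrightarrow> n \<in> carrier N \<Longrightarrow> h (pure m n) = k (pure m n)"
    and Y: "Y \<in> carrier T"
  shows "h Y = k Y"
proof -
  obtain x where x: "x \<in> carrier F" "Y = K #>\<^bsub>F\<^esub> x"
    using Y unfolding tensor_group_def by (auto simp: carrier_FactGroup)
  have "(h \<circ> (\<lambda>x. K #>\<^bsub>F\<^esub> x)) x = (k \<circ> (\<lambda>x. K #>\<^bsub>F\<^esub> x)) x"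
    by (rule free_hom_eqI[OF G hom_compose[OF coset_hom h] hom_compose[OF coset_hom k] _ x(1)])
      (use eq in \<open>simp add: pure_tensor_def\<close>)
  then show ?thesis by (simp add: x(2))
qed

text \<open>The universal property of the tensor product.\<close>
lemma tensor_lift:
  assumes G: "comm_group G" and b: "balanced_map R M N G b"
  obtains h where "h \<in> hom T G"
    "\<And>m n. m \<in> carrier M \<Longrightarrow> n \<in> carrier N \<Longrightarrow> h (pure m n) = b m n"
proof -
  interpret G: comm_group G by (rule G)
  have "case_prod b ` (carrier M \<times> carrier N) \<subseteq> carrier G"
    using b by (auto simp: balanced_map_def)
  then obtain k where k: "k \<in> hom F G"
    and kb: "\<And>x. x \<in> carrier M \<times> carrier N \<Longrightarrow> k (frag_of x) = case_prod b x"
    unfolding tensor_free_def using G.free_Abelian_group_universal by metis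
  interpret k: group_hom F G k by unfold_locales (rule k)
  have "balanced_map R M N G (\<lambda>m n. k (frag_of (m, n)))"
    using b unfolding balanced_map_def by (simp add: kb rsmult_closed smult_closed)
  then have "tensor_relators R M N \<subseteq> kernel F G k"
    using kills_relators_iff_balanced[OF G k] relators_in_F by (auto simp: kernel_def)
  then have "K \<subseteq> kernel F G k"
    unfolding tensor_kernel_def by (rule F.generate_subgroup_incl[OF _ k.subgroup_kernel])
  then obtain h where h: "h \<in> hom T G" "\<And>x. x \<in> carrier F \<Longrightarrow> h (K #>\<^bsub>F\<^esub> x) = k x"
    unfolding tensor_group_def using k.FactGroup_universal_kernel[OF normal_K] by metis
  show thesis by (rule that[OF h(1)]) (simp add: pure_tensor_def h(2) frag_of_in_F kb)
qed

text \<open>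
  The set-theoretic \<^const>\<open>tensor_map\<close>, a union of cosets over representatives, is the homomorphism
  given by the universal property: for every representative \<open>x\<close> of a coset, the coset of the image of
  \<open>x\<close> is the value of that homomorphism, so that the union is over equal sets.
\<close>
lemma tensor_map:
  assumes f: "f \<in> hom (add_monoid M) (add_monoid M)" and g: "g \<in> hom (add_monoid N) (add_monoid N)"
    and f_lin: "\<And>m r. m \<in> carrier M \<Longrightarrow> r \<in> carrier R \<Longrightarrow> f (rsmult M m r) = rsmult M (f m) r"
    and g_lin: "\<And>r n. r \<in> carrier R \<Longrightarrow> n \<in> carrier N \<Longrightarrow> g (r \<odot>\<^bsub>N\<^esub> n) = r \<odot>\<^bsub>N\<^esub> g n"
  shows "tensor_map R M N f g \<in> hom T T"
    and "m \<in> carrier M \<Longrightarrow> n \<in> carrier N \<Longrightarrow> tensor_map R M N f g (pure m n) = pure (f m) (g n)"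
proof -
  have fc: "f m \<in> carrier M" if "m \<in> carrier M" for m using hom_in_carrier[OF f] that by simp
  have gc: "g n \<in> carrier N" if "n \<in> carrier N" for n using hom_in_carrier[OF g] that by simp
  have fa: "f (m \<oplus>\<^bsub>M\<^esub> m') = f m \<oplus>\<^bsub>M\<^esub> f m'" if "m \<in> carrier M" "m' \<in> carrier M" for m m'
    using hom_mult[OF f] that by simp
  have ga: "g (n \<oplus>\<^bsub>N\<^esub> n') = g n \<oplus>\<^bsub>N\<^esub> g n'" if "n \<in> carrier N" "n' \<in> carrier N" for n n'
    using hom_mult[OF g] that by simp
  let ?e = "frag_extend (\<lambda>(m, n). frag_of (f m, g n))"
  have e: "?e \<in> hom F F"
  proof (rule homI)
    show "?e x \<in> carrier F" if "x \<in> carrier F" for x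
    proof -
      have "(\<Union>p\<in>Poly_Mapping.keys x. Poly_Mapping.keys ((\<lambda>(m, n). frag_of (f m, g n)) p))
          \<subseteq> carrier M \<times> carrier N"
        using that fc gc by (auto simp: carrier_F)
      with keys_frag_extend show ?thesis unfolding carrier_F by (intro CollectI) (rule order_trans)
    qed
    show "?e (x \<otimes>\<^bsub>F\<^esub> y) = ?e x \<otimes>\<^bsub>F\<^esub> ?e y" for x y
      by (simp add: tensor_free_def frag_extend_add)
  qed
  have "balanced_map R M N T (\<lambda>m n. pure (f m) (g n))"
    using pure_balanced unfolding balanced_map_def by (simp add: fc gc fa ga f_lin g_lin)
  then obtain h where h: "h \<in> hom T T"
    and hp: "\<And>m n. m \<in> carrier M \<Longrightarrow> n \<in> carrier N \<Longrightarrow> h (pure m n) = pure (f m) (g n)"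
    using tensor_lift[OF comm_group_T] by blast
  have he: "h (K #>\<^bsub>F\<^esub> x) = K #>\<^bsub>F\<^esub> ?e x" if "x \<in> carrier F" for x
  proof -
    have "(h \<circ> (\<lambda>x. K #>\<^bsub>F\<^esub> x)) x = ((\<lambda>x. K #>\<^bsub>F\<^esub> x) \<circ> ?e) x"
      by (rule free_hom_eqI[OF comm_group_T hom_compose[OF coset_hom h]
            hom_compose[OF e coset_hom] _ that])
        (use hp in \<open>simp add: pure_tensor_def\<close>)
    then show ?thesis by simp
  qed
  have eq: "tensor_map R M N f g Y = h Y" if Y: "Y \<in> carrier T" for Y
  proof -
    have "K #>\<^bsub>F\<^esub> ?e x = h Y \<and> x \<in> Y" if x: "x \<in> carrier F" "Y = K #>\<^bsub>F\<^esub> x" for x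
      using he[OF x(1)] x F.rcos_self[OF x(1) subgroup_K] by simp
    moreover have "x \<in> carrier F \<and> Y = K #>\<^bsub>F\<^esub> x" if x: "x \<in> Y" for x
    proof -
      obtain y where y: "y \<in> carrier F" "Y = K #>\<^bsub>F\<^esub> y"
        using Y unfolding tensor_group_def by (auto simp: carrier_FactGroup)
      then show ?thesis
        using x F.repr_independence[OF _ y(1) subgroup_K, of x]
          F.r_coset_subset_G[OF subgroup.subset[OF subgroup_K] y(1)] by auto
    qed
    moreover have "Y \<noteq> {}"
      using Y F.rcos_self[OF _ subgroup_K]
      unfolding tensor_group_def by (auto simp: carrier_FactGroup)
    ultimately show ?thesis unfolding tensor_map_def by blast
  qed
  show "tensor_map R M N f g \<in> hom T T"
    using h eq unfolding hom_def by (auto simp: Pi_iff)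
  show "tensor_map R M N f g (pure m n) = pure (f m) (g n)" if "m \<in> carrier M" "n \<in> carrier N"
    using that by (simp add: eq hp)
qed

end

lemma hom_tensor:
  "hom (add_monoid (tensor R M N ract)) G = hom (tensor_group R M N) G"
  "hom G (add_monoid (tensor R M N ract)) = hom G (tensor_group R M N)"
  by (simp_all add: hom_def tensor_def)

lemma tensor_simps [simp]:
  "carrier (tensor R M N ract) = carrier (tensor_group R M N)"
  "\<zero>\<^bsub>tensor R M N ract\<^esub> = \<one>\<^bsub>tensor_group R M N\<^esub>"
  "x \<oplus>\<^bsub>tensor R M N ract\<^esub> y = x \<otimes>\<^bsub>tensor_group R M N\<^esub> y"
  "q \<odot>\<^bsub>tensor R M N ract\<^esub> x = tensor_map R M N (\<lambda>m. q \<odot>\<^bsub>M\<^esub> m) (\<lambda>n. n) x"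
  "rsmult (tensor R M N ract) = ract"
  by (simp_all add: tensor_def)

lemma (in tensor_factors) abelian_group_tensor: "abelian_group (tensor R M N ract)"
  by (rule abelian_groupI) (auto simp: T.m_ac intro: T.l_inv_ex T.m_comm)


context tensor_factors
begin

text \<open>For actions on different factors, this is what makes the tensor product a bimodule.\<close>
lemma tensor_map_commute:
  assumes f: "f \<in> hom (add_monoid M) (add_monoid M)" and g: "g \<in> hom (add_monoid N) (add_monoid N)"
    and f_lin: "\<And>m r. m \<in> carrier M \<Longrightarrow> r \<in> carrier R \<Longrightarrow> f (rsmult M m r) = rsmult M (f m) r"
    and g_lin: "\<And>r n. r \<in> carrier R \<Longrightarrow> n \<in> carrier N \<Longrightarrow> g (r \<odot>\<^bsub>N\<^esub> n) = r \<odot>\<^bsub>N\<^esub> g n"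
    and f': "f' \<in> hom (add_monoid M) (add_monoid M)" and g': "g' \<in> hom (add_monoid N) (add_monoid N)"
    and f'_lin: "\<And>m r. m \<in> carrier M \<Longrightarrow> r \<in> carrier R \<Longrightarrow> f' (rsmult M m r) = rsmult M (f' m) r"
    and g'_lin: "\<And>r n. r \<in> carrier R \<Longrightarrow> n \<in> carrier N \<Longrightarrow> g' (r \<odot>\<^bsub>N\<^esub> n) = r \<odot>\<^bsub>N\<^esub> g' n"
    and ff': "\<And>m. m \<in> carrier M \<Longrightarrow> f (f' m) = f' (f m)"
    and gg': "\<And>n. n \<in> carrier N \<Longrightarrow> g (g' n) = g' (g n)"
    and Y: "Y \<in> carrier T"
  shows "tensor_map R M N f g (tensor_map R M N f' g' Y) = tensor_map R M N f' g' (tensor_map R M N f g Y)"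
proof -
  let ?h = "tensor_map R M N f g" and ?h' = "tensor_map R M N f' g'"
  note h = tensor_map[OF f g f_lin g_lin] and h' = tensor_map[OF f' g' f'_lin g'_lin]
  have fc: "f m \<in> carrier M" "f' m \<in> carrier M" if "m \<in> carrier M" for m
    using hom_in_carrier[OF f] hom_in_carrier[OF f'] that by simp_all
  have gc: "g n \<in> carrier N" "g' n \<in> carrier N" if "n \<in> carrier N" for n
    using hom_in_carrier[OF g] hom_in_carrier[OF g'] that by simp_all
  have "(?h \<circ> ?h') Y = (?h' \<circ> ?h) Y"
    by (rule tensor_hom_eqI[OF comm_group_T hom_compose[OF h'(1) h(1)] hom_compose[OF h(1) h'(1)] _ Y])
      (simp_all add: h(2) h'(2) fc gc ff' gg')
  then show ?thesis by simp
qed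

lemma left_module_tensor:
  assumes "left_module Q M"
    and bimodule: "\<And>q m r. q \<in> carrier Q \<Longrightarrow> m \<in> carrier M \<Longrightarrow> r \<in> carrier R \<Longrightarrow>
      q \<odot>\<^bsub>M\<^esub> rsmult M m r = rsmult M (q \<odot>\<^bsub>M\<^esub> m) r"
  shows "left_module Q (tensor R M N ract)"
proof -
  interpret M: left_module Q M by fact
  let ?h = "\<lambda>q. tensor_map R M N (\<lambda>m. q \<odot>\<^bsub>M\<^esub> m) (\<lambda>n. n)"
  have id: "(\<lambda>n. n) \<in> hom (add_monoid N) (add_monoid N)" by (simp add: hom_def)
  have h: "?h q \<in> hom T T" if "q \<in> carrier Q" for q
    by (rule tensor_map) (use that id bimodule M.smult_additive in auto)
  have hp: "?h q (pure m n) = pure (q \<odot>\<^bsub>M\<^esub> m) n"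
    if "q \<in> carrier Q" "m \<in> carrier M" "n \<in> carrier N" for q m n
    by (rule tensor_map(2)) (use that id bimodule M.smult_additive in auto)
  have hc: "?h q Y \<in> carrier T" if "q \<in> carrier Q" "Y \<in> carrier T" for q Y
    using hom_in_carrier[OF h] that .
  have sum: "(\<lambda>Y. ?h q Y \<otimes>\<^bsub>T\<^esub> ?h q' Y) \<in> hom T T" if "q \<in> carrier Q" "q' \<in> carrier Q" for q q'
    using that hc by (auto intro!: homI simp: hom_mult[OF h] T.m_ac)
  have pure_add: "pure (m \<oplus>\<^bsub>M\<^esub> m') n = pure m n \<otimes>\<^bsub>T\<^esub> pure m' n"
    if "m \<in> carrier M" "m' \<in> carrier M" "n \<in> carrier N" for m m' n
    using pure_balanced that unfolding balanced_map_def by blast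
  have T: "ring Q" by (rule M.R.ring_axioms)
  show ?thesis
  proof (intro left_module.intro left_module_axioms.intro T abelian_group_tensor)
    show "q \<odot>\<^bsub>tensor R M N ract\<^esub> Y \<in> carrier (tensor R M N ract)"
      if q: "q \<in> carrier Q" and Y: "Y \<in> carrier (tensor R M N ract)" for q Y
      using hc q Y by simp
    show "(q \<oplus>\<^bsub>Q\<^esub> q') \<odot>\<^bsub>tensor R M N ract\<^esub> Y =
        q \<odot>\<^bsub>tensor R M N ract\<^esub> Y \<oplus>\<^bsub>tensor R M N ract\<^esub> q' \<odot>\<^bsub>tensor R M N ract\<^esub> Y"
      if q: "q \<in> carrier Q" and q': "q' \<in> carrier Q" and Y: "Y \<in> carrier (tensor R M N ract)" for q q' Y
      using tensor_hom_eqI[OF comm_group_T h sum[OF q q'], of "q \<oplus>\<^bsub>Q\<^esub> q'" Y] q q' Y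
      by (simp add: hp M.smult_l_distr pure_add)
    show "q \<odot>\<^bsub>tensor R M N ract\<^esub> (Y \<oplus>\<^bsub>tensor R M N ract\<^esub> Y') =
        q \<odot>\<^bsub>tensor R M N ract\<^esub> Y \<oplus>\<^bsub>tensor R M N ract\<^esub> q \<odot>\<^bsub>tensor R M N ract\<^esub> Y'"
      if q: "q \<in> carrier Q" and Y: "Y \<in> carrier (tensor R M N ract)" and Y': "Y' \<in> carrier (tensor R M N ract)" for q Y Y'
      using q Y Y' by (simp add: hom_mult[OF h])
    show "(q \<otimes>\<^bsub>Q\<^esub> q') \<odot>\<^bsub>tensor R M N ract\<^esub> Y =
        q \<odot>\<^bsub>tensor R M N ract\<^esub> (q' \<odot>\<^bsub>tensor R M N ract\<^esub> Y)"
      if q: "q \<in> carrier Q" and q': "q' \<in> carrier Q" and Y: "Y \<in> carrier (tensor R M N ract)" for q q' Y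
      using tensor_hom_eqI[OF comm_group_T h hom_compose[OF h[OF q'] h[OF q]], of "q \<otimes>\<^bsub>Q\<^esub> q'" Y] q q' Y
      by (simp add: hp M.smult_assoc)
    show "\<one>\<^bsub>Q\<^esub> \<odot>\<^bsub>tensor R M N ract\<^esub> Y = Y"
      if Y: "Y \<in> carrier (tensor R M N ract)" for Y
      using tensor_hom_eqI[OF comm_group_T h, of "\<one>\<^bsub>Q\<^esub>" "\<lambda>Y. Y" Y] Y
      by (simp add: hp) (simp add: hom_def)
  qed
qed

end

section \<open>Bimodules and their invariants\<close>

lemma abelian_group_cong:
  assumes "abelian_group M" and "carrier N = carrier M"
    and "\<And>x y. x \<in> carrier M \<Longrightarrow> y \<in> carrier M \<Longrightarrow> x \<oplus>\<^bsub>N\<^esub> y = x \<oplus>\<^bsub>M\<^esub> y"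
    and "\<zero>\<^bsub>N\<^esub> = \<zero>\<^bsub>M\<^esub>"
  shows "abelian_group N"
proof -
  interpret M: abelian_group M by fact
  show ?thesis
    by (rule abelian_groupI) (use M.l_neg M.a_inv_closed in \<open>auto simp: assms(2-) M.a_ac\<close>)
qed

lemma left_module_ring_bimodule:
  assumes "ring A" and "ring R" and f: "f \<in> ring_hom R A"
  shows "left_module R (ring_bimodule A f g)"
proof -
  interpret A: ring A by fact
  interpret f: ring_hom_ring R A f by (rule ring_hom_ringI2) fact+
  have "abelian_group (ring_bimodule A f g)"
    by (rule abelian_group_cong[OF A.abelian_group_axioms]) (simp_all add: ring_bimodule_def)
  then show ?thesis
    by (intro left_module.intro left_module_axioms.intro assms)
      (simp_all add: ring_bimodule_def A.l_distr A.r_distr A.m_assoc)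
qed

text \<open>
  An \<open>A\<close>-\<open>C\<close>-bimodule \<open>D\<close> with a map \<open>f : C \<rightarrow> A\<close>, through which \<open>C\<close> acts on \<open>D\<close> from the left as well.
  Two instances are of interest: \<open>A \<otimes>\<^sub>B A\<close> and \<open>A \<otimes>\<^sub>V P\<close>.
\<close>
locale scalar_bimodule = left_module A D
  for A :: "('a, 'x) ring_scheme" (structure) and D :: "('a, 'm, 'c) bimodule" (structure) +
  fixes C :: "('c, 'z) ring_scheme" and f :: "'c \<Rightarrow> 'a"
  assumes f_closed [simp]: "c \<in> carrier C \<Longrightarrow> f c \<in> carrier A"
    and rsmult_closed [simp]: "\<lbrakk>x \<in> carrier D; c \<in> carrier C\<rbrakk> \<Longrightarrow> rsmult D x c \<in> carrier D"
    and rsmult_add: "\<lbrakk>x \<in> carrier D; y \<in> carrier D; c \<in> carrier C\<rbrakk> \<Longrightarrow>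
      rsmult D (x \<oplus>\<^bsub>D\<^esub> y) c = rsmult D x c \<oplus>\<^bsub>D\<^esub> rsmult D y c"
    and smult_rsmult: "\<lbrakk>a \<in> carrier A; x \<in> carrier D; c \<in> carrier C\<rbrakk> \<Longrightarrow>
      a \<odot>\<^bsub>D\<^esub> rsmult D x c = rsmult D (a \<odot>\<^bsub>D\<^esub> x) c"
begin

abbreviation "V \<equiv> centralizer_ring A C f"

definition invariant_elements :: "'m set" where
  "invariant_elements = {x \<in> carrier D. \<forall>c\<in>carrier C. f c \<odot>\<^bsub>D\<^esub> x = rsmult D x c}"

definition invariant_module :: "('a, 'm) module" where
  "invariant_module = (module.truncate D)\<lparr>carrier := invariant_elements\<rparr>"

abbreviation "P \<equiv> invariant_module"

lemma P_simps [simp]: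
  "carrier P = invariant_elements" "\<zero>\<^bsub>P\<^esub> = \<zero>\<^bsub>D\<^esub>" "x \<oplus>\<^bsub>P\<^esub> y = x \<oplus>\<^bsub>D\<^esub> y" "a \<odot>\<^bsub>P\<^esub> x = a \<odot>\<^bsub>D\<^esub> x"
  by (simp_all add: invariant_module_def module.defs)

lemma V_simps [simp]:
  "carrier V = {a \<in> carrier A. \<forall>c\<in>carrier C. f c \<otimes>\<^bsub>A\<^esub> a = a \<otimes>\<^bsub>A\<^esub> f c}"
  "x \<oplus>\<^bsub>V\<^esub> y = x \<oplus>\<^bsub>A\<^esub> y" "x \<otimes>\<^bsub>V\<^esub> y = x \<otimes>\<^bsub>A\<^esub> y" "\<zero>\<^bsub>V\<^esub> = \<zero>\<^bsub>A\<^esub>" "\<one>\<^bsub>V\<^esub> = \<one>\<^bsub>A\<^esub>"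
  by (auto simp: centralizer_ring_def invariants_def ring_bimodule_def)

lemma rsmult_additive:
  "c \<in> carrier C \<Longrightarrow> (\<lambda>x. rsmult D x c) \<in> hom (add_monoid D) (add_monoid D)"
  by (auto simp: hom_def rsmult_add)

lemma rsmult_zero: "c \<in> carrier C \<Longrightarrow> rsmult D \<zero>\<^bsub>D\<^esub> c = \<zero>\<^bsub>D\<^esub>"
  using hom_one[OF rsmult_additive M.a_group M.a_group] by simp

lemma invariant_closed: "x \<in> invariant_elements \<Longrightarrow> x \<in> carrier D"
  by (simp add: invariant_elements_def)

lemma subring_V: "subring (carrier V) A"
proof (rule R.subringI)
  show "\<ominus>\<^bsub>A\<^esub> a \<in> carrier V" if "a \<in> carrier V" for a
    using that by (auto simp: R.l_minus R.r_minus)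
  show "a \<otimes>\<^bsub>A\<^esub> b \<in> carrier V" if a: "a \<in> carrier V" and b: "b \<in> carrier V" for a b
  proof -
    have "f c \<otimes>\<^bsub>A\<^esub> (a \<otimes>\<^bsub>A\<^esub> b) = a \<otimes>\<^bsub>A\<^esub> b \<otimes>\<^bsub>A\<^esub> f c" if "c \<in> carrier C" for c
    proof -
      have "f c \<otimes>\<^bsub>A\<^esub> (a \<otimes>\<^bsub>A\<^esub> b) = a \<otimes>\<^bsub>A\<^esub> f c \<otimes>\<^bsub>A\<^esub> b"
        using a b that by (simp flip: R.m_assoc)
      then show ?thesis using a b that by (simp add: R.m_assoc)
    qed
    then show ?thesis using a b by simp
  qed
qed (auto simp: R.l_distr R.r_distr)

lemma ring_V: "ring V"
proof -
  have "V = A\<lparr>carrier := carrier V\<rparr>" by (simp add: centralizer_ring_def)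
  then show ?thesis using R.subring_is_ring[OF subring_V] by metis
qed

text \<open>
  An element of \<open>V\<close> maps \<open>P\<close> to itself as it commutes with the image of \<open>C\<close>. Negatives need no separate
  argument since \<open>-1 \<in> V\<close>.
\<close>
lemma left_module_P: "left_module V P"
proof -
  have smult: "v \<odot>\<^bsub>D\<^esub> x \<in> invariant_elements" if v: "v \<in> carrier V" and x: "x \<in> invariant_elements" for v x
  proof -
    have "f c \<odot>\<^bsub>D\<^esub> (v \<odot>\<^bsub>D\<^esub> x) = rsmult D (v \<odot>\<^bsub>D\<^esub> x) c" if c: "c \<in> carrier C" for c
    proof -
      have "f c \<odot>\<^bsub>D\<^esub> (v \<odot>\<^bsub>D\<^esub> x) = (f c \<otimes>\<^bsub>A\<^esub> v) \<odot>\<^bsub>D\<^esub> x"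
        using v x c by (simp add: invariant_closed flip: smult_assoc)
      also have "\<dots> = v \<odot>\<^bsub>D\<^esub> (f c \<odot>\<^bsub>D\<^esub> x)"
        using v x c by (simp add: smult_assoc invariant_closed)
      also have "\<dots> = rsmult D (v \<odot>\<^bsub>D\<^esub> x) c"
        using v x c by (simp add: invariant_elements_def smult_rsmult)
      finally show ?thesis .
    qed
    then show ?thesis using v x by (simp add: invariant_elements_def)
  qed
  have minus_one: "\<ominus>\<^bsub>A\<^esub> \<one>\<^bsub>A\<^esub> \<in> carrier V" by (simp add: R.l_minus R.r_minus)
  have minus: "\<exists>y\<in>carrier P. y \<oplus>\<^bsub>P\<^esub> x = \<zero>\<^bsub>P\<^esub>" if "x \<in> carrier P" for x
  proof
    have "(\<ominus>\<^bsub>A\<^esub> \<one>\<^bsub>A\<^esub> \<oplus>\<^bsub>A\<^esub> \<one>\<^bsub>A\<^esub>) \<odot>\<^bsub>D\<^esub> x = \<zero>\<^bsub>D\<^esub>"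
      using that by (simp add: R.l_neg invariant_closed)
    then show "(\<ominus>\<^bsub>A\<^esub> \<one>\<^bsub>A\<^esub>) \<odot>\<^bsub>D\<^esub> x \<oplus>\<^bsub>P\<^esub> x = \<zero>\<^bsub>P\<^esub>"
      using that smult_l_distr[of "\<ominus>\<^bsub>A\<^esub> \<one>\<^bsub>A\<^esub>" "\<one>\<^bsub>A\<^esub>" x] by (simp add: invariant_closed)
  qed (use smult minus_one that in auto)
  have "abelian_group P"
    by (rule abelian_groupI)
      (use minus in \<open>auto simp: invariant_elements_def smult_r_distr rsmult_add rsmult_zero M.a_ac\<close>)
  then show ?thesis
    by (intro left_module.intro left_module_axioms.intro ring_V)
      (use smult in \<open>auto simp: smult_l_distr smult_r_distr smult_assoc invariant_closed\<close>)
qed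

text \<open>
  The requirements on \<open>t\<close> and \<open>g\<close> amount to right \<open>C\<close>-linearity of \<open>u \<mapsto> \<Sum> u\<^sub>i t\<^sub>i\<close> and of
  \<open>x \<mapsto> (g\<^sub>i(x))\<^sub>i\<close>, respectively.
\<close>
definition bimodule_dual_basis :: "'i set \<Rightarrow> ('i \<Rightarrow> 'm) \<Rightarrow> ('i \<Rightarrow> 'm \<Rightarrow> 'a) \<Rightarrow> bool" where
  "bimodule_dual_basis F t g \<longleftrightarrow> dual_basis F t g \<and> t \<in> F \<rightarrow> invariant_elements \<and>
     (\<forall>i\<in>F. \<forall>x\<in>carrier D. \<forall>c\<in>carrier C. g i (rsmult D x c) = g i x \<otimes>\<^bsub>A\<^esub> f c)"

text \<open>
  As a left module, \<open>A\<^sup>n\<close> is the free module on \<open>{..<n}\<close>, so that a retraction is a dual basis.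
  The unit vectors satisfy \<open>f(c) e\<^sub>i = e\<^sub>i f(c)\<close>; hence their images under a bimodule map are invariant.
\<close>
lemma summand_of_power_iff_dual_basis:
  "bimodule_iso_direct_summand A C D (bimodule_power n (ring_bimodule A (\<lambda>a. a) f)) \<longleftrightarrow>
     (\<exists>t g. bimodule_dual_basis {..<n} t g)" (is "_ \<longleftrightarrow> ?db")
proof -
  let ?I = "{..<n}"
  let ?W = "bimodule_power n (ring_bimodule A (\<lambda>a. a) f)" and ?U = "free_module A {..<n}"
  interpret U: left_module A ?U by (rule left_module_free_module) (rule R.ring_axioms)
  have carrier: "carrier ?W = carrier ?U"
    by (simp add: bimodule_power_def free_module_def ring_bimodule_def)
  have add: "x \<oplus>\<^bsub>?W\<^esub> y = x \<oplus>\<^bsub>?U\<^esub> y" for x y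
    by (simp add: bimodule_power_def free_module_def ring_bimodule_def)
  have smult: "a \<odot>\<^bsub>?W\<^esub> x = a \<odot>\<^bsub>?U\<^esub> x" for a x
    by (simp add: bimodule_power_def free_module_def ring_bimodule_def)
  have zero: "\<zero>\<^bsub>?W\<^esub> = \<zero>\<^bsub>?U\<^esub>"
    by (simp add: bimodule_power_def free_module_def ring_bimodule_def)
  have addi: "(x \<oplus>\<^bsub>?W\<^esub> y) i = (if i < n then x i \<oplus>\<^bsub>A\<^esub> y i else undefined)" for x y i
    by (simp add: bimodule_power_def ring_bimodule_def)
  have rsmult: "rsmult ?W w c = (\<lambda>i\<in>?I. w i \<otimes>\<^bsub>A\<^esub> f c)" for w c
    by (simp add: bimodule_power_def ring_bimodule_def)
  have hom: "hom (add_monoid ?W) G = hom (add_monoid ?U) G" "hom G (add_monoid ?W) = hom G (add_monoid ?U)"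
    for G :: "('g, 'w) monoid_scheme"
    by (auto simp: hom_def carrier add)
  have comp: "w i \<in> carrier A" if "w \<in> carrier ?U" "i < n" for w i
    using free_module_component_closed[of w A ?I i] that by simp
  have "abelian_group ?W"
    by (rule abelian_group_cong[OF U.abelian_group_axioms carrier]) (simp_all add: add zero)
  moreover have "(\<lambda>w. rsmult ?W w c) \<in> hom (add_monoid ?W) (add_monoid ?W)" if "c \<in> carrier C" for c
  proof (rule homI)
    show "rsmult ?W w c \<in> carrier (add_monoid ?W)" if "w \<in> carrier (add_monoid ?W)" for w
      using that comp f_closed[OF \<open>c \<in> carrier C\<close>] by (simp add: carrier rsmult) (simp add: free_module_def)
    show "rsmult ?W (w \<otimes>\<^bsub>add_monoid ?W\<^esub> w') c = rsmult ?W w c \<otimes>\<^bsub>add_monoid ?W\<^esub> rsmult ?W w' c"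
      if "w \<in> carrier (add_monoid ?W)" "w' \<in> carrier (add_monoid ?W)" for w w'
    proof
      fix i
      show "rsmult ?W (w \<otimes>\<^bsub>add_monoid ?W\<^esub> w') c i
          = (rsmult ?W w c \<otimes>\<^bsub>add_monoid ?W\<^esub> rsmult ?W w' c) i"
      proof (cases "i < n")
        case True
        then have "w i \<in> carrier A" "w' i \<in> carrier A" using that comp by (simp_all add: carrier)
        then show ?thesis using True f_closed[OF \<open>c \<in> carrier C\<close>] by (simp add: rsmult addi R.l_distr)
      qed (simp add: rsmult addi)
    qed
  qed
  moreover have "(\<lambda>w. a \<odot>\<^bsub>?W\<^esub> w) \<in> hom (add_monoid ?W) (add_monoid ?W)" if "a \<in> carrier A" for a
    unfolding hom smult using U.smult_additive[OF that] .
  ultimately have iff: "bimodule_iso_direct_summand A C D ?W \<longleftrightarrow>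
    (\<exists>\<iota>\<in>hom (add_monoid D) (add_monoid ?W). \<exists>\<pi>\<in>hom (add_monoid ?W) (add_monoid D).
       (\<forall>r\<in>carrier A. \<forall>x\<in>carrier D. \<iota> (r \<odot>\<^bsub>D\<^esub> x) = r \<odot>\<^bsub>?W\<^esub> \<iota> x) \<and>
       (\<forall>s\<in>carrier C. \<forall>x\<in>carrier D. \<iota> (rsmult D x s) = rsmult ?W (\<iota> x) s) \<and>
       (\<forall>r\<in>carrier A. \<forall>w\<in>carrier ?W. \<pi> (r \<odot>\<^bsub>?W\<^esub> w) = r \<odot>\<^bsub>D\<^esub> \<pi> w) \<and>
       (\<forall>s\<in>carrier C. \<forall>w\<in>carrier ?W. \<pi> (rsmult ?W w s) = rsmult D (\<pi> w) s) \<and>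
       (\<forall>x\<in>carrier D. \<pi> (\<iota> x) = x))"
    by (intro bimodule_iso_direct_summand_iff_retract) (auto intro: M.abelian_group_axioms)
  show ?thesis
  proof
    assume "bimodule_iso_direct_summand A C D ?W"
    then obtain \<iota> \<pi> where \<iota>: "\<iota> \<in> hom (add_monoid D) (add_monoid ?U)"
      and \<pi>: "\<pi> \<in> hom (add_monoid ?U) (add_monoid D)"
      and \<iota>_left: "\<forall>r\<in>carrier A. \<forall>x\<in>carrier D. \<iota> (r \<odot>\<^bsub>D\<^esub> x) = r \<odot>\<^bsub>?U\<^esub> \<iota> x"
      and \<iota>_right: "\<forall>s\<in>carrier C. \<forall>x\<in>carrier D. \<iota> (rsmult D x s) = rsmult ?W (\<iota> x) s"
      and \<pi>_left: "\<forall>r\<in>carrier A. \<forall>w\<in>carrier ?U. \<pi> (r \<odot>\<^bsub>?U\<^esub> w) = r \<odot>\<^bsub>D\<^esub> \<pi> w"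
      and \<pi>_right: "\<forall>s\<in>carrier C. \<forall>w\<in>carrier ?U. \<pi> (rsmult ?W w s) = rsmult D (\<pi> w) s"
      and \<pi>\<iota>: "\<forall>x\<in>carrier D. \<pi> (\<iota> x) = x"
      unfolding iff hom unfolding smult carrier by (elim bexE conjE) (rule that)
    let ?e = "unit_vector A ?I"
    have e: "?e i \<in> carrier ?U" for i by (rule unit_vector_closed) (rule R.ring_axioms)
    have "dual_basis ?I (\<lambda>i. \<pi> (?e i)) (\<lambda>i x. \<iota> x i)"
      using \<iota>_left \<pi>_left \<pi>\<iota> by (intro dual_basis_of_retract[OF \<iota> \<pi>]) auto
    moreover have "\<pi> (?e i) \<in> invariant_elements" if "i < n" for i
    proof -
      have "f c \<odot>\<^bsub>D\<^esub> \<pi> (?e i) = rsmult D (\<pi> (?e i)) c" if c: "c \<in> carrier C" for c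
      proof -
        have "f c \<odot>\<^bsub>?U\<^esub> ?e i = rsmult ?W (?e i) c"
          using c by (auto simp: rsmult unit_vector_def free_module_def)
        then show ?thesis using \<pi>_left \<pi>_right c e by (metis f_closed)
      qed
      then show ?thesis
        using hom_in_carrier[OF \<pi>] e by (simp add: invariant_elements_def)
    qed
    moreover have "\<iota> (rsmult D x c) i = \<iota> x i \<otimes>\<^bsub>A\<^esub> f c"
      if "i < n" "x \<in> carrier D" "c \<in> carrier C" for i x c
      using \<iota>_right that by (simp add: rsmult)
    ultimately have "bimodule_dual_basis ?I (\<lambda>i. \<pi> (?e i)) (\<lambda>i x. \<iota> x i)"
      unfolding bimodule_dual_basis_def by auto
    then show ?db by blast
  next
    assume ?db
    then obtain t g where db: "dual_basis ?I t g" and t: "\<And>i. i < n \<Longrightarrow> t i \<in> invariant_elements"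
      and g_right: "\<And>i x c. i < n \<Longrightarrow> x \<in> carrier D \<Longrightarrow> c \<in> carrier C \<Longrightarrow>
                      g i (rsmult D x c) = g i x \<otimes>\<^bsub>A\<^esub> f c"
      unfolding bimodule_dual_basis_def by fastforce
    note r = retract_of_dual_basis[OF db]
    let ?\<iota> = "\<lambda>x. \<lambda>i\<in>?I. g i x" and ?\<pi> = "\<lambda>u. \<Oplus>\<^bsub>D\<^esub>i\<in>?I. u i \<odot>\<^bsub>D\<^esub> t i"
    have \<iota>_right: "?\<iota> (rsmult D x c) = rsmult ?W (?\<iota> x) c" if "c \<in> carrier C" "x \<in> carrier D" for c x
      using that g_right by (auto simp: rsmult)
    have \<pi>_right: "?\<pi> (rsmult ?W w c) = rsmult D (?\<pi> w) c" if c: "c \<in> carrier C" and w: "w \<in> carrier ?U" for c w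
    proof -
      have wt: "(\<lambda>i. w i \<odot>\<^bsub>D\<^esub> t i) \<in> ?I \<rightarrow> carrier D" using w t comp invariant_closed by auto
      have "rsmult D (?\<pi> w) c = (\<Oplus>\<^bsub>D\<^esub>i\<in>?I. rsmult D (w i \<odot>\<^bsub>D\<^esub> t i) c)"
        by (rule hom_finsum[OF M.abelian_group_axioms M.abelian_group_axioms rsmult_additive[OF c] wt])
      also have "\<dots> = ?\<pi> (rsmult ?W w c)"
      proof (rule M.finsum_cong')
        fix i assume i: "i \<in> ?I"
        have "rsmult D (w i \<odot>\<^bsub>D\<^esub> t i) c = w i \<odot>\<^bsub>D\<^esub> rsmult D (t i) c"
          using i w c t comp by (simp add: smult_rsmult invariant_closed)
        also have "rsmult D (t i) c = f c \<odot>\<^bsub>D\<^esub> t i"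
          using i c t by (simp add: invariant_elements_def)
        finally show "rsmult D (w i \<odot>\<^bsub>D\<^esub> t i) c = rsmult ?W w c i \<odot>\<^bsub>D\<^esub> t i"
          using i w c t comp by (simp add: rsmult smult_assoc invariant_closed)
      qed (use w t comp c invariant_closed in \<open>auto simp: rsmult\<close>)
      finally show ?thesis by simp
    qed
    show "bimodule_iso_direct_summand A C D ?W"
      unfolding iff hom unfolding smult carrier
      by (intro bexI[OF _ r(1)] bexI[OF _ r(2)] conjI ballI r(3-5) \<iota>_right \<pi>_right)
  qed
qed

text \<open>
  A dual basis can be indexed by a nonempty initial segment of the natural numbers. The extra index
  \<open>card F\<close>, with the element \<open>0\<close> and the functional \<open>0\<close>, ensures \<open>n > 0\<close> also when \<open>F\<close> is empty.
\<close>
lemma dual_basis_pad: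
  assumes "bimodule_dual_basis F t g"
  shows "\<exists>n>0. \<exists>t' g'. bimodule_dual_basis {..<n::nat} t' g'"
proof -
  have F: "finite F" and tc: "\<And>i. i \<in> F \<Longrightarrow> t i \<in> carrier D" and t: "\<And>i. i \<in> F \<Longrightarrow> t i \<in> invariant_elements"
    and g: "\<And>i. i \<in> F \<Longrightarrow> g i \<in> hom (add_monoid D) (add_monoid A)"
    and left: "\<And>i a x. i \<in> F \<Longrightarrow> a \<in> carrier A \<Longrightarrow> x \<in> carrier D \<Longrightarrow> g i (a \<odot>\<^bsub>D\<^esub> x) = a \<otimes>\<^bsub>A\<^esub> g i x"
    and right: "\<And>i x c. i \<in> F \<Longrightarrow> x \<in> carrier D \<Longrightarrow> c \<in> carrier C \<Longrightarrow> g i (rsmult D x c) = g i x \<otimes>\<^bsub>A\<^esub> f c"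
    and sum: "\<And>x. x \<in> carrier D \<Longrightarrow> (\<Oplus>\<^bsub>D\<^esub>i\<in>F. g i x \<odot>\<^bsub>D\<^esub> t i) = x"
    using assms unfolding bimodule_dual_basis_def dual_basis_def by auto
  have gc: "g i x \<in> carrier A" if "i \<in> F" "x \<in> carrier D" for i x
    using hom_in_carrier[OF g] that by simp
  obtain e where e: "bij_betw e {..<card F} F"
    using ex_bij_betw_nat_finite[OF F] by (auto simp: lessThan_atLeast0)
  let ?n = "card F"
  have eF: "e j \<in> F" if "j < ?n" for j using e that by (auto simp: bij_betw_def)
  define t' where "t' j = (if j < ?n then t (e j) else \<zero>\<^bsub>D\<^esub>)" for j
  define g' where "g' j = (if j < ?n then g (e j) else (\<lambda>_. \<zero>\<^bsub>A\<^esub>))" for j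
  have sum': "(\<Oplus>\<^bsub>D\<^esub>j\<in>{..<Suc ?n}. g' j x \<odot>\<^bsub>D\<^esub> t' j) = x" if x: "x \<in> carrier D" for x
  proof -
    have "(\<Oplus>\<^bsub>D\<^esub>j\<in>{..<Suc ?n}. g' j x \<odot>\<^bsub>D\<^esub> t' j) = (\<Oplus>\<^bsub>D\<^esub>j\<in>{..<?n}. g' j x \<odot>\<^bsub>D\<^esub> t' j)"
      unfolding lessThan_Suc using x tc gc eF
      by (subst M.finsum_insert) (auto simp: g'_def t'_def intro!: M.l_zero M.finsum_closed)
    also have "\<dots> = (\<Oplus>\<^bsub>D\<^esub>j\<in>{..<?n}. g (e j) x \<odot>\<^bsub>D\<^esub> t (e j))"
      using x tc gc eF by (intro M.finsum_cong') (auto simp: g'_def t'_def)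
    also have "\<dots> = (\<Oplus>\<^bsub>D\<^esub>i\<in>e ` {..<?n}. g i x \<odot>\<^bsub>D\<^esub> t i)"
      using x tc gc eF e by (intro M.finsum_reindex[symmetric]) (auto simp: bij_betw_def)
    also have "e ` {..<?n} = F" using e by (simp add: bij_betw_def)
    finally show ?thesis using sum[OF x] by simp
  qed
  have zero: "\<zero>\<^bsub>D\<^esub> \<in> invariant_elements" by (simp add: invariant_elements_def rsmult_zero)
  have "g' j \<in> hom (add_monoid D) (add_monoid A)" for j
    using g eF by (auto simp: g'_def hom_def)
  then have "bimodule_dual_basis {..<Suc ?n} t' g'"
    unfolding bimodule_dual_basis_def dual_basis_def using left right eF t tc sum' zero
    by (auto simp: g'_def t'_def)
  then show ?thesis by blast
qed

end

lemma bimodule_dual_basis_transport: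
  assumes D: "scalar_bimodule A D C f" and E: "scalar_bimodule A E C f"
    and iso: "bimodule_isomorphic A C D E"
    and db: "scalar_bimodule.bimodule_dual_basis A D C f F t g"
  shows "\<exists>t' g'. scalar_bimodule.bimodule_dual_basis A E C f F t' g'"
proof -
  interpret D: scalar_bimodule A D C f by (rule D)
  interpret E: scalar_bimodule A E C f by (rule E)
  obtain k where k: "k \<in> iso (add_monoid D) (add_monoid E)"
    and k_left: "\<And>a x. a \<in> carrier A \<Longrightarrow> x \<in> carrier D \<Longrightarrow> k (a \<odot>\<^bsub>D\<^esub> x) = a \<odot>\<^bsub>E\<^esub> k x"
    and k_right: "\<And>c x. c \<in> carrier C \<Longrightarrow> x \<in> carrier D \<Longrightarrow> k (rsmult D x c) = rsmult E (k x) c"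
    using iso unfolding bimodule_isomorphic_def by blast
  have kh: "k \<in> hom (add_monoid D) (add_monoid E)" using k by (simp add: iso_def)
  have kc: "k x \<in> carrier E" if "x \<in> carrier D" for x using hom_in_carrier[OF kh] that by simp
  have bij: "bij_betw k (carrier D) (carrier E)" using k by (simp add: iso_def)
  define l where "l = inv_into (carrier D) k"
  have lc: "l y \<in> carrier D" if "y \<in> carrier E" for y
    using bij_betw_apply[OF bij_betw_inv_into[OF bij]] that by (simp add: l_def)
  have kl: "k (l y) = y" if "y \<in> carrier E" for y
    using bij_betw_inv_into_right[OF bij that] by (simp add: l_def)
  have lI: "l y = x" if "x \<in> carrier D" "k x = y" for x y
    using bij_betw_inv_into_left[OF bij that(1)] that by (simp add: l_def)
  have l: "l \<in> hom (add_monoid E) (add_monoid D)"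
    using hom_mult[OF kh] by (auto intro!: homI lI simp: lc kl)
  have l_left: "l (a \<odot>\<^bsub>E\<^esub> y) = a \<odot>\<^bsub>D\<^esub> l y" if "a \<in> carrier A" "y \<in> carrier E" for a y
    using that by (intro lI) (simp_all add: lc kl k_left)
  have l_right: "l (rsmult E y c) = rsmult D (l y) c" if "c \<in> carrier C" "y \<in> carrier E" for c y
    using that by (intro lI) (simp_all add: lc kl k_right)
  have F: "finite F" and tc: "\<And>i. i \<in> F \<Longrightarrow> t i \<in> carrier D"
    and t: "\<And>i. i \<in> F \<Longrightarrow> t i \<in> D.invariant_elements"
    and g: "\<And>i. i \<in> F \<Longrightarrow> g i \<in> hom (add_monoid D) (add_monoid A)"
    and left: "\<And>i a x. i \<in> F \<Longrightarrow> a \<in> carrier A \<Longrightarrow> x \<in> carrier D \<Longrightarrow> g i (a \<odot>\<^bsub>D\<^esub> x) = a \<otimes>\<^bsub>A\<^esub> g i x"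
    and right: "\<And>i x c. i \<in> F \<Longrightarrow> x \<in> carrier D \<Longrightarrow> c \<in> carrier C \<Longrightarrow> g i (rsmult D x c) = g i x \<otimes>\<^bsub>A\<^esub> f c"
    and sum: "\<And>x. x \<in> carrier D \<Longrightarrow> (\<Oplus>\<^bsub>D\<^esub>i\<in>F. g i x \<odot>\<^bsub>D\<^esub> t i) = x"
    using db unfolding D.bimodule_dual_basis_def D.dual_basis_def by auto
  have gc: "g i x \<in> carrier A" if "i \<in> F" "x \<in> carrier D" for i x
    using hom_in_carrier[OF g] that by simp
  have "(\<Oplus>\<^bsub>E\<^esub>i\<in>F. g i (l y) \<odot>\<^bsub>E\<^esub> k (t i)) = y" if y: "y \<in> carrier E" for y
  proof -
    have "k (\<Oplus>\<^bsub>D\<^esub>i\<in>F. g i (l y) \<odot>\<^bsub>D\<^esub> t i) = (\<Oplus>\<^bsub>E\<^esub>i\<in>F. k (g i (l y) \<odot>\<^bsub>D\<^esub> t i))"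
      using gc tc lc y
      by (intro hom_finsum[OF D.M.abelian_group_axioms E.M.abelian_group_axioms kh]) auto
    also have "\<dots> = (\<Oplus>\<^bsub>E\<^esub>i\<in>F. g i (l y) \<odot>\<^bsub>E\<^esub> k (t i))"
      using gc tc lc y kc by (intro E.M.finsum_cong') (auto simp: k_left)
    finally show ?thesis using sum[OF lc[OF y]] kl[OF y] by simp
  qed
  moreover have "(\<lambda>y. g i (l y)) \<in> hom (add_monoid E) (add_monoid A)" if "i \<in> F" for i
    using hom_compose[OF l g[OF that]] by (simp add: comp_def)
  moreover have "k (t i) \<in> E.invariant_elements" if "i \<in> F" for i
  proof -
    have "f c \<odot>\<^bsub>E\<^esub> k (t i) = rsmult E (k (t i)) c" if c: "c \<in> carrier C" for c
    proof -
      have "f c \<odot>\<^bsub>D\<^esub> t i = rsmult D (t i) c" using t[OF \<open>i \<in> F\<close>] c by (simp add: D.invariant_elements_def)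
      then show ?thesis using k_left[of "f c" "t i"] k_right[of c "t i"] c tc[OF \<open>i \<in> F\<close>] by simp
    qed
    then show ?thesis using kc tc that by (simp add: E.invariant_elements_def)
  qed
  ultimately have "E.bimodule_dual_basis F (\<lambda>i. k (t i)) (\<lambda>i y. g i (l y))"
    unfolding E.bimodule_dual_basis_def E.dual_basis_def
    using F left right by (auto simp: lc kc tc l_left l_right)
  then show ?thesis by blast
qed

section \<open>Induction of the invariants\<close>

context scalar_bimodule
begin

abbreviation "AV \<equiv> ring_bimodule A (\<lambda>a. a) (\<lambda>v. v)"
abbreviation "AP \<equiv> tensor_AP A C f P"

lemma AV_simps [simp]:
  "carrier AV = carrier A" "x \<oplus>\<^bsub>AV\<^esub> y = x \<oplus>\<^bsub>A\<^esub> y" "a \<odot>\<^bsub>AV\<^esub> x = a \<otimes>\<^bsub>A\<^esub> x" "rsmult AV x v = x \<otimes>\<^bsub>A\<^esub> v"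
  by (simp_all add: ring_bimodule_def)

lemma left_module_AV: "left_module A AV"
  by (rule left_module_ring_bimodule) (auto simp: R.ring_axioms intro: ring_hom_memI)

lemma tensor_factors_AP: "tensor_factors V AV P"
proof -
  interpret AV: left_module A AV by (rule left_module_AV)
  interpret P: left_module V P by (rule left_module_P)
  show ?thesis
    by (intro tensor_factors.intro AV.M.abelian_group_axioms P.M.abelian_group_axioms
        tensor_factors_axioms.intro) (use P.smult_closed in auto)
qed

sublocale AP: tensor_factors V AV P by (rule tensor_factors_AP)

lemma AP_eq: "AP = tensor V AV P (\<lambda>Y c. tensor_map V AV P (\<lambda>m. m \<otimes>\<^bsub>A\<^esub> f c) (\<lambda>p. p) Y)"
  by (simp add: tensor_AP_def Let_def)

lemma id_hom_P: "(\<lambda>p. p) \<in> hom (add_monoid P) (add_monoid P)"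
  by (simp add: hom_def)

lemma left_hom_AV: "a \<in> carrier A \<Longrightarrow> (\<lambda>m. a \<odot>\<^bsub>AV\<^esub> m) \<in> hom (add_monoid AV) (add_monoid AV)"
  by (auto simp: hom_def R.r_distr)

lemma right_hom_AV: "c \<in> carrier C \<Longrightarrow> (\<lambda>m. m \<otimes>\<^bsub>A\<^esub> f c) \<in> hom (add_monoid AV) (add_monoid AV)"
  by (auto simp: hom_def R.l_distr)

lemma right_AV_balanced:
  "c \<in> carrier C \<Longrightarrow> m \<in> carrier AV \<Longrightarrow> v \<in> carrier V \<Longrightarrow>
    rsmult AV m v \<otimes>\<^bsub>A\<^esub> f c = rsmult AV (m \<otimes>\<^bsub>A\<^esub> f c) v"
  by (simp add: R.m_assoc)

lemma carrier_AP [simp]: "carrier AP = carrier AP.T"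
  by (simp add: AP_eq)

lemma add_AP [simp]: "Y \<oplus>\<^bsub>AP\<^esub> Y' = Y \<otimes>\<^bsub>AP.T\<^esub> Y'"
  by (simp add: AP_eq)

lemma hom_AP: "hom (add_monoid AP) G = hom AP.T G" "hom G (add_monoid AP) = hom G AP.T"
  unfolding AP_eq by (rule hom_tensor)+

lemma AP_left:
  assumes "a \<in> carrier A"
  shows "(\<lambda>Y. a \<odot>\<^bsub>AP\<^esub> Y) \<in> hom AP.T AP.T"
    and "m \<in> carrier A \<Longrightarrow> p \<in> invariant_elements \<Longrightarrow> a \<odot>\<^bsub>AP\<^esub> AP.pure m p = AP.pure (a \<otimes>\<^bsub>A\<^esub> m) p"
  using AP.tensor_map[OF left_hom_AV[OF assms] id_hom_P] assms
  by (auto simp: AP_eq R.m_assoc)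

lemma AP_right:
  assumes "c \<in> carrier C"
  shows "(\<lambda>Y. rsmult AP Y c) \<in> hom AP.T AP.T"
    and "m \<in> carrier A \<Longrightarrow> p \<in> invariant_elements \<Longrightarrow> rsmult AP (AP.pure m p) c = AP.pure (m \<otimes>\<^bsub>A\<^esub> f c) p"
  using AP.tensor_map[OF right_hom_AV[OF assms] id_hom_P right_AV_balanced[OF assms]]
  by (simp_all add: AP_eq)

lemma scalar_bimodule_AP: "scalar_bimodule A AP C f"
proof (intro scalar_bimodule.intro scalar_bimodule_axioms.intro)
  show "left_module A AP"
    unfolding AP_eq by (rule AP.left_module_tensor[OF left_module_AV]) (simp add: R.m_assoc)
  show "a \<odot>\<^bsub>AP\<^esub> rsmult AP Y c = rsmult AP (a \<odot>\<^bsub>AP\<^esub> Y) c"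
    if "a \<in> carrier A" "Y \<in> carrier AP" "c \<in> carrier C" for a Y c
    using AP.tensor_hom_eqI[OF AP.comm_group_T hom_compose[OF AP_right(1)[OF that(3)] AP_left(1)[OF that(1)]]
        hom_compose[OF AP_left(1)[OF that(1)] AP_right(1)[OF that(3)]], of Y] that
    by (simp add: AP_left AP_right R.m_assoc)
qed (use hom_in_carrier[OF AP_right(1)] hom_mult[OF AP_right(1)] in auto)


lemma AP_pure:
  "m \<in> carrier A \<Longrightarrow> p \<in> invariant_elements \<Longrightarrow> AP.pure m p \<in> carrier AP.T"
  "m \<in> carrier A \<Longrightarrow> m' \<in> carrier A \<Longrightarrow> p \<in> invariant_elements \<Longrightarrow>
     AP.pure (m \<oplus>\<^bsub>A\<^esub> m') p = AP.pure m p \<otimes>\<^bsub>AP.T\<^esub> AP.pure m' p"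
  "m \<in> carrier A \<Longrightarrow> p \<in> invariant_elements \<Longrightarrow> p' \<in> invariant_elements \<Longrightarrow>
     AP.pure m (p \<oplus>\<^bsub>D\<^esub> p') = AP.pure m p \<otimes>\<^bsub>AP.T\<^esub> AP.pure m p'"
  "m \<in> carrier A \<Longrightarrow> v \<in> carrier V \<Longrightarrow> p \<in> invariant_elements \<Longrightarrow>
     AP.pure (m \<otimes>\<^bsub>A\<^esub> v) p = AP.pure m (v \<odot>\<^bsub>D\<^esub> p)"
  using AP.pure_balanced unfolding balanced_map_def by auto

text \<open>
  Since the scalars \<open>h\<^sub>i(p)\<close> lie in \<open>V\<close>, they can be moved across the tensor sign:
  \<open>\<Sum> m h\<^sub>i(p) \<otimes> t\<^sub>i = m \<otimes> \<Sum> h\<^sub>i(p) t\<^sub>i = m \<otimes> p\<close>.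
\<close>
lemma pure_dual_basis:
  assumes db: "left_module.dual_basis V P F t h" and m: "m \<in> carrier A" and p: "p \<in> invariant_elements"
  shows "(\<Oplus>\<^bsub>AP\<^esub>i\<in>F. AP.pure (m \<otimes>\<^bsub>A\<^esub> h i p) (t i)) = AP.pure m p"
proof -
  interpret P: left_module V P by (rule left_module_P)
  interpret AP': scalar_bimodule A AP C f by (rule scalar_bimodule_AP)
  have t: "\<And>i. i \<in> F \<Longrightarrow> t i \<in> invariant_elements"
    and h: "\<And>i. i \<in> F \<Longrightarrow> h i \<in> hom (add_monoid P) (add_monoid V)"
    and sum: "(\<Oplus>\<^bsub>P\<^esub>i\<in>F. h i p \<odot>\<^bsub>P\<^esub> t i) = p"
    using db p unfolding P.dual_basis_def by auto
  have hV: "h i p \<in> carrier V" if "i \<in> F" for i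
    using hom_in_carrier[OF h[OF that], of p] p by simp
  have ht: "h i p \<odot>\<^bsub>P\<^esub> t i \<in> carrier P" if "i \<in> F" for i
    using P.smult_closed[of "h i p" "t i"] hV t that by simp
  have hom: "(\<lambda>p. AP.pure m p) \<in> hom (add_monoid P) (add_monoid AP)"
    using m by (auto simp: hom_def AP_pure)
  have "AP.pure m p = AP.pure m (\<Oplus>\<^bsub>P\<^esub>i\<in>F. h i p \<odot>\<^bsub>P\<^esub> t i)" by (simp only: sum)
  also have "\<dots> = (\<Oplus>\<^bsub>AP\<^esub>i\<in>F. AP.pure m (h i p \<odot>\<^bsub>P\<^esub> t i))"
    using ht by (intro hom_finsum[OF AP.N.abelian_group_axioms AP'.M.abelian_group_axioms hom]) auto
  also have "\<dots> = (\<Oplus>\<^bsub>AP\<^esub>i\<in>F. AP.pure (m \<otimes>\<^bsub>A\<^esub> h i p) (t i))"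
    using hV ht t m by (intro AP'.M.finsum_cong') (auto simp: AP_pure)
  finally show ?thesis by simp
qed

text \<open>
  The functionals are the extensions \<open>a \<otimes> p \<mapsto> a h\<^sub>i(p)\<close> of the given ones, the elements are \<open>1 \<otimes> t\<^sub>i\<close>.
\<close>
lemma bimodule_dual_basis_AP:
  assumes db: "left_module.dual_basis V P F t h"
  shows "\<exists>t' g'. scalar_bimodule.bimodule_dual_basis A AP C f F t' g'"
proof -
  interpret P: left_module V P by (rule left_module_P)
  interpret AP': scalar_bimodule A AP C f by (rule scalar_bimodule_AP)
  have F: "finite F" and t: "\<And>i. i \<in> F \<Longrightarrow> t i \<in> invariant_elements"
    and h: "\<And>i. i \<in> F \<Longrightarrow> h i \<in> hom (add_monoid P) (add_monoid V)"
    and lin: "\<And>i v p. i \<in> F \<Longrightarrow> v \<in> carrier V \<Longrightarrow> p \<in> invariant_elements \<Longrightarrow>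
                h i (v \<odot>\<^bsub>D\<^esub> p) = v \<otimes>\<^bsub>A\<^esub> h i p"
    using db unfolding P.dual_basis_def by (simp_all add: Pi_iff)
  have hV: "h i p \<in> carrier V" if "i \<in> F" "p \<in> invariant_elements" for i p
    using hom_in_carrier[OF h[OF that(1)], of p] that by simp
  have h_add: "h i (p \<oplus>\<^bsub>D\<^esub> p') = h i p \<oplus>\<^bsub>A\<^esub> h i p'"
    if "i \<in> F" "p \<in> invariant_elements" "p' \<in> invariant_elements" for i p p'
    using hom_mult[OF h[OF that(1)], of p p'] that by simp
  have A: "comm_group (add_monoid A)" by (rule R.a_comm_group)
  have "\<exists>G. G \<in> hom AP.T (add_monoid A) \<and>
      (\<forall>m\<in>carrier A. \<forall>p\<in>invariant_elements. G (AP.pure m p) = m \<otimes>\<^bsub>A\<^esub> h i p)" if i: "i \<in> F" for i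
  proof -
    have "balanced_map V AV P (add_monoid A) (\<lambda>m p. m \<otimes>\<^bsub>A\<^esub> h i p)"
      unfolding balanced_map_def using hV[OF i] h_add[OF i] lin[OF i]
      by (auto simp: R.l_distr R.r_distr R.m_assoc)
    then obtain G where "G \<in> hom AP.T (add_monoid A)"
      "\<And>m p. m \<in> carrier AV \<Longrightarrow> p \<in> carrier P \<Longrightarrow> G (AP.pure m p) = m \<otimes>\<^bsub>A\<^esub> h i p"
      using AP.tensor_lift[OF A] by blast
    then show ?thesis by auto
  qed
  then obtain G where G: "\<And>i. i \<in> F \<Longrightarrow> G i \<in> hom AP.T (add_monoid A)"
    and Gp: "\<And>i m p. i \<in> F \<Longrightarrow> m \<in> carrier A \<Longrightarrow> p \<in> invariant_elements \<Longrightarrow>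
               G i (AP.pure m p) = m \<otimes>\<^bsub>A\<^esub> h i p"
    by metis
  have Gc: "G i Y \<in> carrier A" if "i \<in> F" "Y \<in> carrier AP.T" for i Y
    using hom_in_carrier[OF G[OF that(1)] that(2)] by simp
  have G_left: "G i (a \<odot>\<^bsub>AP\<^esub> Y) = a \<otimes>\<^bsub>A\<^esub> G i Y"
    if "i \<in> F" "a \<in> carrier A" "Y \<in> carrier AP.T" for i a Y
  proof -
    have mult: "(\<lambda>x. a \<otimes>\<^bsub>A\<^esub> x) \<in> hom (add_monoid A) (add_monoid A)"
      using that by (auto simp: hom_def R.r_distr)
    show ?thesis
      using AP.tensor_hom_eqI[OF A hom_compose[OF AP_left(1)[OF that(2)] G[OF that(1)]]
          hom_compose[OF G[OF that(1)] mult] _ that(3)] that hV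
      by (simp add: AP_left Gp R.m_assoc)
  qed
  have G_right: "G i (rsmult AP Y c) = G i Y \<otimes>\<^bsub>A\<^esub> f c"
    if "i \<in> F" "c \<in> carrier C" "Y \<in> carrier AP.T" for i c Y
  proof -
    have mult: "(\<lambda>x. x \<otimes>\<^bsub>A\<^esub> f c) \<in> hom (add_monoid A) (add_monoid A)"
      using that by (auto simp: hom_def R.l_distr)
    show ?thesis
      using AP.tensor_hom_eqI[OF A hom_compose[OF AP_right(1)[OF that(2)] G[OF that(1)]]
          hom_compose[OF G[OF that(1)] mult] _ that(3)] that hV
      by (simp add: AP_right Gp R.m_assoc)
  qed
  let ?t = "\<lambda>i. AP.pure \<one>\<^bsub>A\<^esub> (t i)"
  have tT: "?t i \<in> carrier AP.T" if "i \<in> F" for i using t that by (simp add: AP_pure)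
  have inv: "?t i \<in> AP'.invariant_elements" if "i \<in> F" for i
    using t that tT by (simp add: AP'.invariant_elements_def AP_left AP_right)
  have sum: "(\<Oplus>\<^bsub>AP\<^esub>i\<in>F. G i Y \<odot>\<^bsub>AP\<^esub> ?t i) = Y" if Y: "Y \<in> carrier AP.T" for Y
  proof (rule AP.tensor_hom_eqI[OF AP.comm_group_T, of _ "\<lambda>Y. Y", OF _ _ _ Y])
    have closed: "(\<lambda>i. G i Y \<odot>\<^bsub>AP\<^esub> ?t i) \<in> F \<rightarrow> carrier AP" if "Y \<in> carrier AP.T" for Y
      using AP'.smult_closed Gc tT that by auto
    show "(\<lambda>Y. \<Oplus>\<^bsub>AP\<^esub>i\<in>F. G i Y \<odot>\<^bsub>AP\<^esub> ?t i) \<in> hom AP.T AP.T"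
    proof (rule homI)
      show "(\<Oplus>\<^bsub>AP\<^esub>i\<in>F. G i Y \<odot>\<^bsub>AP\<^esub> ?t i) \<in> carrier AP.T" if "Y \<in> carrier AP.T" for Y
        using AP'.M.finsum_closed[OF closed[OF that]] by simp
      show "(\<Oplus>\<^bsub>AP\<^esub>i\<in>F. G i (Y \<otimes>\<^bsub>AP.T\<^esub> Y') \<odot>\<^bsub>AP\<^esub> ?t i) =
          (\<Oplus>\<^bsub>AP\<^esub>i\<in>F. G i Y \<odot>\<^bsub>AP\<^esub> ?t i) \<otimes>\<^bsub>AP.T\<^esub> (\<Oplus>\<^bsub>AP\<^esub>i\<in>F. G i Y' \<odot>\<^bsub>AP\<^esub> ?t i)"
        if Y: "Y \<in> carrier AP.T" "Y' \<in> carrier AP.T" for Y Y'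
      proof -
        have "(\<Oplus>\<^bsub>AP\<^esub>i\<in>F. G i (Y \<otimes>\<^bsub>AP.T\<^esub> Y') \<odot>\<^bsub>AP\<^esub> ?t i)
            = (\<Oplus>\<^bsub>AP\<^esub>i\<in>F. G i Y \<odot>\<^bsub>AP\<^esub> ?t i \<oplus>\<^bsub>AP\<^esub> G i Y' \<odot>\<^bsub>AP\<^esub> ?t i)"
        proof (rule AP'.M.finsum_cong')
          show "(\<lambda>i. G i Y \<odot>\<^bsub>AP\<^esub> ?t i \<oplus>\<^bsub>AP\<^esub> G i Y' \<odot>\<^bsub>AP\<^esub> ?t i) \<in> F \<rightarrow> carrier AP"
            using closed[OF Y(1)] closed[OF Y(2)] AP'.M.a_closed by blast
          fix i assume i: "i \<in> F"
          show "G i (Y \<otimes>\<^bsub>AP.T\<^esub> Y') \<odot>\<^bsub>AP\<^esub> ?t i = G i Y \<odot>\<^bsub>AP\<^esub> ?t i \<oplus>\<^bsub>AP\<^esub> G i Y' \<odot>\<^bsub>AP\<^esub> ?t i"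
            using AP'.smult_l_distr[of "G i Y" "G i Y'" "?t i"] hom_mult[OF G[OF i] Y] Gc i Y tT by simp
        qed simp
        also have "\<dots> = (\<Oplus>\<^bsub>AP\<^esub>i\<in>F. G i Y \<odot>\<^bsub>AP\<^esub> ?t i) \<oplus>\<^bsub>AP\<^esub> (\<Oplus>\<^bsub>AP\<^esub>i\<in>F. G i Y' \<odot>\<^bsub>AP\<^esub> ?t i)"
          by (rule AP'.M.finsum_addf[OF closed[OF Y(1)] closed[OF Y(2)]])
        finally show ?thesis by simp
      qed
    qed
    show "(\<lambda>Y. Y) \<in> hom AP.T AP.T" by (simp add: hom_def)
    fix m p assume "m \<in> carrier AV" "p \<in> carrier P"
    then have m: "m \<in> carrier A" and p: "p \<in> invariant_elements" by simp_all
    have "(\<Oplus>\<^bsub>AP\<^esub>i\<in>F. G i (AP.pure m p) \<odot>\<^bsub>AP\<^esub> ?t i)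
        = (\<Oplus>\<^bsub>AP\<^esub>i\<in>F. AP.pure (m \<otimes>\<^bsub>A\<^esub> h i p) (t i))"
      using m p t hV by (intro AP'.M.finsum_cong') (auto simp: Gp AP_left AP_pure(1))
    then show "(\<Oplus>\<^bsub>AP\<^esub>i\<in>F. G i (AP.pure m p) \<odot>\<^bsub>AP\<^esub> ?t i) = AP.pure m p"
      using pure_dual_basis[OF db m p] by simp
  qed
  have "AP'.bimodule_dual_basis F ?t G"
    unfolding AP'.bimodule_dual_basis_def AP'.dual_basis_def hom_AP
    using F tT inv G G_left G_right sum by auto
  then show ?thesis by blast
qed

text \<open>
  Right \<open>C\<close>-linearity of \<open>g\<^sub>i\<close> sends invariants to the centralizer, which gives the first claim. For the
  second, multiplication \<open>\<mu> : a \<otimes> p \<mapsto> a p\<close> and \<open>\<nu> : x \<mapsto> \<Sum> g\<^sub>i(x) \<otimes> t\<^sub>i\<close> are mutually inverse, and \<open>\<mu>\<close> is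
  right \<open>C\<close>-linear because \<open>(a c) p = a (c p) = a (p c)\<close>.
\<close>
lemma
  assumes db: "bimodule_dual_basis F t g"
  shows dual_basis_invariants: "left_module.dual_basis V P F t g"
    and isomorphic_of_bimodule_dual_basis: "bimodule_isomorphic A C AP D"
proof -
  interpret P: left_module V P by (rule left_module_P)
  interpret AP': scalar_bimodule A AP C f by (rule scalar_bimodule_AP)
  have F: "finite F" and t: "\<And>i. i \<in> F \<Longrightarrow> t i \<in> invariant_elements"
    and g: "\<And>i. i \<in> F \<Longrightarrow> g i \<in> hom (add_monoid D) (add_monoid A)"
    and left: "\<And>i a x. i \<in> F \<Longrightarrow> a \<in> carrier A \<Longrightarrow> x \<in> carrier D \<Longrightarrow> g i (a \<odot>\<^bsub>D\<^esub> x) = a \<otimes>\<^bsub>A\<^esub> g i x"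
    and right: "\<And>i x c. i \<in> F \<Longrightarrow> x \<in> carrier D \<Longrightarrow> c \<in> carrier C \<Longrightarrow> g i (rsmult D x c) = g i x \<otimes>\<^bsub>A\<^esub> f c"
    and sum: "\<And>x. x \<in> carrier D \<Longrightarrow> (\<Oplus>\<^bsub>D\<^esub>i\<in>F. g i x \<odot>\<^bsub>D\<^esub> t i) = x"
    using db unfolding bimodule_dual_basis_def dual_basis_def by auto
  have gc: "g i x \<in> carrier A" if "i \<in> F" "x \<in> carrier D" for i x
    using hom_in_carrier[OF g] that by simp
  have g_add: "g i (x \<oplus>\<^bsub>D\<^esub> y) = g i x \<oplus>\<^bsub>A\<^esub> g i y" if "i \<in> F" "x \<in> carrier D" "y \<in> carrier D" for i x y
    using hom_mult[OF g[OF that(1)], of x y] that by simp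
  have gV: "g i p \<in> carrier V" if "i \<in> F" "p \<in> invariant_elements" for i p
  proof -
    have p: "p \<in> carrier D" using that invariant_closed by blast
    have "f c \<otimes>\<^bsub>A\<^esub> g i p = g i p \<otimes>\<^bsub>A\<^esub> f c" if c: "c \<in> carrier C" for c
    proof -
      have "f c \<otimes>\<^bsub>A\<^esub> g i p = g i (f c \<odot>\<^bsub>D\<^esub> p)" using left[of i "f c" p] \<open>i \<in> F\<close> c p by simp
      also have "\<dots> = g i (rsmult D p c)"
        using \<open>p \<in> invariant_elements\<close> c by (simp add: invariant_elements_def)
      also have "\<dots> = g i p \<otimes>\<^bsub>A\<^esub> f c" by (rule right) (use \<open>i \<in> F\<close> c p in auto)
      finally show ?thesis .
    qed
    then show ?thesis using gc[OF that(1) p] by simp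
  qed
  show dbP: "P.dual_basis F t g"
    unfolding P.dual_basis_def
  proof (intro conjI ballI)
    show "g i \<in> hom (add_monoid P) (add_monoid V)" if "i \<in> F" for i
      using gV[OF that] g_add[OF that] invariant_closed by (auto intro!: homI)
    show "g i (v \<odot>\<^bsub>P\<^esub> p) = v \<otimes>\<^bsub>V\<^esub> g i p" if "i \<in> F" "v \<in> carrier V" "p \<in> carrier P" for i v p
      using that left invariant_closed by simp
    show "(\<Oplus>\<^bsub>P\<^esub>i\<in>F. g i p \<odot>\<^bsub>P\<^esub> t i) = p" if p: "p \<in> carrier P" for p
    proof -
      have incl: "(\<lambda>p. p) \<in> hom (add_monoid P) (add_monoid D)"
        using invariant_closed by (auto simp: hom_def)
      have "(\<lambda>i. g i p \<odot>\<^bsub>P\<^esub> t i) \<in> F \<rightarrow> carrier P"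
        using P.smult_closed gV t p by auto
      from hom_finsum[OF AP.N.abelian_group_axioms M.abelian_group_axioms incl this]
      show ?thesis using sum[of p] p invariant_closed by simp
    qed
  qed (use F t in auto)
  have "balanced_map V AV P (add_monoid D) (\<lambda>a p. a \<odot>\<^bsub>D\<^esub> p)"
    unfolding balanced_map_def
    using invariant_closed by (auto simp: smult_l_distr smult_r_distr smult_assoc)
  then obtain \<mu> where \<mu>: "\<mu> \<in> hom AP.T (add_monoid D)"
    and \<mu>p: "\<And>a p. a \<in> carrier A \<Longrightarrow> p \<in> invariant_elements \<Longrightarrow> \<mu> (AP.pure a p) = a \<odot>\<^bsub>D\<^esub> p"
    using AP.tensor_lift[OF M.a_comm_group] by auto
  have \<mu>c: "\<mu> Y \<in> carrier D" if "Y \<in> carrier AP.T" for Y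
    using hom_in_carrier[OF \<mu> that] by simp
  define \<nu> where "\<nu> x = (\<Oplus>\<^bsub>AP\<^esub>i\<in>F. AP.pure (g i x) (t i))" for x
  have closed: "(\<lambda>i. AP.pure (g i x) (t i)) \<in> F \<rightarrow> carrier AP" if "x \<in> carrier D" for x
    using gc t that by (auto simp: AP_pure)
  have \<nu>c: "\<nu> x \<in> carrier AP.T" if "x \<in> carrier D" for x
    unfolding \<nu>_def using AP'.M.finsum_closed[OF closed[OF that]] by simp
  have \<nu>: "\<nu> \<in> hom (add_monoid D) AP.T"
  proof (rule homI)
    fix x y assume "x \<in> carrier (add_monoid D)" "y \<in> carrier (add_monoid D)"
    then have xy: "x \<in> carrier D" "y \<in> carrier D" by simp_all
    have "\<nu> (x \<oplus>\<^bsub>D\<^esub> y) = (\<Oplus>\<^bsub>AP\<^esub>i\<in>F. AP.pure (g i x) (t i) \<oplus>\<^bsub>AP\<^esub> AP.pure (g i y) (t i))"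
      unfolding \<nu>_def using xy gc t
      by (intro AP'.M.finsum_cong') (auto simp: g_add AP_pure)
    also have "\<dots> = \<nu> x \<oplus>\<^bsub>AP\<^esub> \<nu> y"
      unfolding \<nu>_def by (rule AP'.M.finsum_addf[OF closed[OF xy(1)] closed[OF xy(2)]])
    finally show "\<nu> (x \<otimes>\<^bsub>add_monoid D\<^esub> y) = \<nu> x \<otimes>\<^bsub>AP.T\<^esub> \<nu> y" by simp
  qed (simp add: \<nu>c)
  have \<mu>\<nu>: "\<mu> (\<nu> x) = x" if x: "x \<in> carrier D" for x
  proof -
    have "\<mu> \<in> hom (add_monoid AP) (add_monoid D)" using \<mu> by (simp only: hom_AP)
    from hom_finsum[OF AP'.M.abelian_group_axioms M.abelian_group_axioms this closed[OF x]]
    have "\<mu> (\<nu> x) = (\<Oplus>\<^bsub>D\<^esub>i\<in>F. \<mu> (AP.pure (g i x) (t i)))" by (simp add: \<nu>_def)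
    also have "\<dots> = (\<Oplus>\<^bsub>D\<^esub>i\<in>F. g i x \<odot>\<^bsub>D\<^esub> t i)"
      using gc t x invariant_closed by (intro M.finsum_cong') (auto simp: \<mu>p)
    finally show ?thesis using sum[OF x] by simp
  qed
  have \<nu>\<mu>: "\<nu> (\<mu> Y) = Y" if Y: "Y \<in> carrier AP.T" for Y
  proof -
    have "\<nu> (\<mu> (AP.pure m p)) = AP.pure m p" if m: "m \<in> carrier A" and p: "p \<in> invariant_elements" for m p
    proof -
      have "\<nu> (\<mu> (AP.pure m p)) = (\<Oplus>\<^bsub>AP\<^esub>i\<in>F. AP.pure (m \<otimes>\<^bsub>A\<^esub> g i p) (t i))"
        unfolding \<nu>_def \<mu>p[OF m p] using m p t gc invariant_closed
        by (intro AP'.M.finsum_cong') (auto simp: left AP_pure)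
      then show ?thesis using pure_dual_basis[OF dbP m p] by simp
    qed
    then show ?thesis
      using AP.tensor_hom_eqI[OF AP.comm_group_T hom_compose[OF \<mu> \<nu>], of "\<lambda>Y. Y" Y] Y
      by (simp add: hom_def)
  qed
  have "bij_betw \<mu> (carrier AP.T) (carrier D)"
    by (rule bij_betw_byWitness[where f' = \<nu>]) (use \<mu>\<nu> \<nu>\<mu> \<mu>c \<nu>c in auto)
  moreover have "\<mu> \<in> hom (add_monoid AP) (add_monoid D)"
    using \<mu> by (simp only: hom_AP)
  ultimately have "\<mu> \<in> iso (add_monoid AP) (add_monoid D)"
    by (simp add: iso_def)
  moreover have "\<mu> (a \<odot>\<^bsub>AP\<^esub> Y) = a \<odot>\<^bsub>D\<^esub> \<mu> Y" if "a \<in> carrier A" "Y \<in> carrier AP" for a Y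
    using AP.tensor_hom_eqI[OF M.a_comm_group hom_compose[OF AP_left(1)[OF that(1)] \<mu>]
        hom_compose[OF \<mu> smult_additive[OF that(1)]], of Y] that
    by (simp add: AP_left \<mu>p smult_assoc invariant_closed)
  moreover have "\<mu> (rsmult AP Y c) = rsmult D (\<mu> Y) c" if "c \<in> carrier C" "Y \<in> carrier AP" for c Y
  proof -
    have "(m \<otimes>\<^bsub>A\<^esub> f c) \<odot>\<^bsub>D\<^esub> p = rsmult D (m \<odot>\<^bsub>D\<^esub> p) c"
      if "m \<in> carrier A" "p \<in> invariant_elements" for m p
      using that \<open>c \<in> carrier C\<close> invariant_closed[OF that(2)]
      by (simp add: smult_assoc smult_rsmult[symmetric]) (simp add: invariant_elements_def)
    then show ?thesis
      using AP.tensor_hom_eqI[OF M.a_comm_group hom_compose[OF AP_right(1)[OF that(1)] \<mu>]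
        hom_compose[OF \<mu> rsmult_additive[OF that(1)]], of Y] that
      by (simp add: AP_right \<mu>p)
  qed
  ultimately show "bimodule_isomorphic A C AP D"
    unfolding bimodule_isomorphic_def by blast
qed

theorem summand_of_power_iff_invariants:
  "(\<exists>n>0. bimodule_iso_direct_summand A C D (bimodule_power n (ring_bimodule A (\<lambda>a. a) f))) \<longleftrightarrow>
     finitely_generated V P \<and> projective_module V P \<and> bimodule_isomorphic A C AP D"
proof -
  interpret P: left_module V P by (rule left_module_P)
  show ?thesis
  proof
    assume "\<exists>n>0. bimodule_iso_direct_summand A C D (bimodule_power n (ring_bimodule A (\<lambda>a. a) f))"
    then obtain n :: nat and t g where db: "bimodule_dual_basis {..<n} t g"
      unfolding summand_of_power_iff_dual_basis by blast
    have "finitely_generated V P \<and> projective_module V P"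
      unfolding P.finitely_generated_projective_iff_dual_basis
      using P.dual_basis_collapse[OF dual_basis_invariants[OF db]] by blast
    then show "finitely_generated V P \<and> projective_module V P \<and> bimodule_isomorphic A C AP D"
      using isomorphic_of_bimodule_dual_basis[OF db] by blast
  next
    assume *: "finitely_generated V P \<and> projective_module V P \<and> bimodule_isomorphic A C AP D"
    then obtain F and t :: "'m \<Rightarrow> 'm" and h where "P.dual_basis F t h"
      using P.finitely_generated_projective_iff_dual_basis by blast
    then obtain t' g' where "scalar_bimodule.bimodule_dual_basis A AP C f F t' g'"
      using bimodule_dual_basis_AP by blast
    then obtain t'' g'' where "bimodule_dual_basis F t'' g''"
      using bimodule_dual_basis_transport[OF scalar_bimodule_AP scalar_bimodule_axioms] * by blast
    then show "\<exists>n>0. bimodule_iso_direct_summand A C D (bimodule_power n (ring_bimodule A (\<lambda>a. a) f))"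
      unfolding summand_of_power_iff_dual_basis by (rule dual_basis_pad)
  qed
qed

end

section \<open>Towers of rings\<close>

lemma tensor_factors_AA:
  assumes "ring A" and "ring B" and "\<phi> \<in> ring_hom B A"
  shows "tensor_factors B (ring_bimodule A (\<lambda>a. a) \<phi>) (ring_bimodule A \<phi> (\<lambda>a. a))"
proof -
  interpret A: ring A by fact
  interpret M: left_module A "ring_bimodule A (\<lambda>a. a) \<phi>"
    by (rule left_module_ring_bimodule) (auto simp: assms intro: ring_hom_memI)
  interpret N: left_module B "ring_bimodule A \<phi> (\<lambda>a. a)"
    by (rule left_module_ring_bimodule) (rule assms)+
  show ?thesis
    by (intro tensor_factors.intro M.M.abelian_group_axioms N.M.abelian_group_axioms
        tensor_factors_axioms.intro N.smult_closed)
      (auto simp: ring_bimodule_def ring_hom_closed[OF assms(3)])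
qed

lemma restrict_right_simps [simp]:
  "carrier (restrict_right g M) = carrier M" "\<zero>\<^bsub>restrict_right g M\<^esub> = \<zero>\<^bsub>M\<^esub>"
  "x \<oplus>\<^bsub>restrict_right g M\<^esub> y = x \<oplus>\<^bsub>M\<^esub> y" "r \<odot>\<^bsub>restrict_right g M\<^esub> x = r \<odot>\<^bsub>M\<^esub> x"
  "rsmult (restrict_right g M) x t = rsmult M x (g t)"
  "module.truncate (restrict_right g M) = module.truncate M"
  by (simp_all add: restrict_right_def module.defs bimodule.defs)

text \<open>The left action is on the first factor and the right action on the second, so they commute.\<close>
lemma scalar_bimodule_tensor_AA:
  assumes A: "ring A" and B: "ring B" and \<phi>: "\<phi> \<in> ring_hom B A"
    and g: "\<And>c. c \<in> carrier C \<Longrightarrow> g c \<in> carrier A"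
  shows "scalar_bimodule A (restrict_right g (tensor_AA A B \<phi>)) C g"
proof -
  interpret A: ring A by (rule A)
  let ?M = "ring_bimodule A (\<lambda>a. a) \<phi>" and ?N = "ring_bimodule A \<phi> (\<lambda>a. a)"
  let ?l = "\<lambda>a m. a \<odot>\<^bsub>?M\<^esub> m" and ?r = "\<lambda>c n. rsmult ?N n (g c)"
  interpret M: left_module A ?M
    by (rule left_module_ring_bimodule) (auto simp: A intro: ring_hom_memI)
  interpret T: tensor_factors B ?M ?N by (rule tensor_factors_AA[OF A B \<phi>])
  define T where "T = tensor_AA A B \<phi>"
  have T_eq: "T = tensor B ?M ?N (\<lambda>Y a. tensor_map B ?M ?N (\<lambda>m. m) (\<lambda>n. rsmult ?N n a) Y)"
    by (simp add: T_def tensor_AA_def Let_def)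
  have idM: "(\<lambda>m. m) \<in> hom (add_monoid ?M) (add_monoid ?M)"
    and idN: "(\<lambda>n. n) \<in> hom (add_monoid ?N) (add_monoid ?N)"
    by (simp_all add: hom_def)
  have l: "?l a \<in> hom (add_monoid ?M) (add_monoid ?M)" if "a \<in> carrier A" for a
    by (rule M.smult_additive[OF that])
  have l_lin: "?l a (rsmult ?M m b) = rsmult ?M (?l a m) b"
    if "a \<in> carrier A" "m \<in> carrier ?M" "b \<in> carrier B" for a m b
    using that ring_hom_closed[OF \<phi>] by (simp add: ring_bimodule_def A.m_assoc)
  have r: "?r c \<in> hom (add_monoid ?N) (add_monoid ?N)" if "c \<in> carrier C" for c
    using g[OF that] by (auto simp: hom_def ring_bimodule_def A.l_distr)
  have r_lin: "?r c (b \<odot>\<^bsub>?N\<^esub> n) = b \<odot>\<^bsub>?N\<^esub> ?r c n"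
    if "c \<in> carrier C" "b \<in> carrier B" "n \<in> carrier ?N" for c b n
    using that g ring_hom_closed[OF \<phi>] by (simp add: ring_bimodule_def A.m_assoc)
  have left: "left_module A T"
    unfolding T_eq by (rule T.left_module_tensor[OF M.left_module_axioms l_lin])
  then interpret D: left_module A T .
  have rT: "(\<lambda>Y. rsmult T Y (g c)) \<in> hom (tensor_group B ?M ?N) (tensor_group B ?M ?N)"
    if "c \<in> carrier C" for c
    unfolding T_eq tensor_simps by (rule T.tensor_map(1)[OF idM r[OF that] _ r_lin[OF that]]) simp_all
  have carrier_T: "carrier T = carrier (tensor_group B ?M ?N)" by (simp add: T_eq)
  have add_T: "Y \<oplus>\<^bsub>T\<^esub> Y' = Y \<otimes>\<^bsub>tensor_group B ?M ?N\<^esub> Y'" for Y Y' by (simp add: T_eq)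
  have group: "abelian_group (restrict_right g T)"
    by (rule abelian_group_cong[OF D.M.abelian_group_axioms]) simp_all
  have comm: "a \<odot>\<^bsub>T\<^esub> rsmult T Y (g c) = rsmult T (a \<odot>\<^bsub>T\<^esub> Y) (g c)"
    if "a \<in> carrier A" "Y \<in> carrier T" "c \<in> carrier C" for a Y c
    unfolding T_eq tensor_simps
    by (rule T.tensor_map_commute[OF l[OF that(1)] idN l_lin[OF that(1)] _ idM r[OF that(3)] _ r_lin[OF that(3)]])
      (use that in \<open>simp_all add: carrier_T\<close>)
  show ?thesis
    unfolding T_def[symmetric]
  proof (intro scalar_bimodule.intro left_module.intro left_module_axioms.intro
      scalar_bimodule_axioms.intro A group)
  qed (use hom_in_carrier[OF rT] hom_mult[OF rT] in
      \<open>auto simp: g comm D.smult_l_distr D.smult_r_distr D.smult_assoc carrier_T[symmetric] add_T[symmetric]\<close>)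
qed

theorem theorem4p6:
  fixes A :: "('a, 'x) ring_scheme" and B :: "('b, 'y) ring_scheme" and C :: "('c, 'z) ring_scheme"
    and \<phi> :: "'b \<Rightarrow> 'a" and \<psi> :: "'c \<Rightarrow> 'b"
  assumes "ring A" and "ring B" and "ring C"
    and "\<phi> \<in> ring_hom B A" and "\<psi> \<in> ring_hom C B"
  shows "right_depth_three A B C \<phi> \<psi> \<longleftrightarrow>
    (let V = centralizer_ring A C (\<phi> \<circ> \<psi>);
         P = tensor_AA_invariants A B C \<phi> \<psi>
     in finitely_generated V P \<and> projective_module V P \<and>
        bimodule_isomorphic A C
          (tensor_AP A C (\<phi> \<circ> \<psi>) P)
          (restrict_right (\<phi> \<circ> \<psi>) (tensor_AA A B \<phi>)))"
proof -
  interpret D: scalar_bimodule A "restrict_right (\<phi> \<circ> \<psi>) (tensor_AA A B \<phi>)" C "\<phi> \<circ> \<psi>"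
    by (rule scalar_bimodule_tensor_AA)
      (use assms in \<open>auto intro: ring_hom_closed\<close>)
  have "D.invariant_module = tensor_AA_invariants A B C \<phi> \<psi>"
    by (simp add: D.invariant_module_def D.invariant_elements_def tensor_AA_invariants_def
        invariants_def)
  then show ?thesis
    using D.summand_of_power_iff_invariants by (simp add: right_depth_three_def Let_def)
qed

end
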